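(* Let $r_1,\ldots,r_m>0$ and let $M=\prod_{i=1}^m S^2_{r_i}$ be the product of two-spheres of radii $r_i$ with the diagonal circle action by rotation about the $z$-axis. Assume $0$ is a regular value of the moment map $\mu$. Put $\mathcal{A}=\{1,\ldots,m\}$ and let $\bar K_+,\bar K_-\subset\mathbb{C}[t,\tilde x_1,\ldots,\tilde x_m]$ be the ideals defined in the context. Consider the families of polynomials (i) $(\tilde x_j-r_jt)(\tilde x_j+r_jt)$, for $j\in\mathcal{A}$; (ii) $P_J=\prod_{j\in J}(\tilde x_j-r_jt)$, for $J\subset\mathcal{A}$ long; (iii) $Q_J=\prod_{j\in J}(\tilde x_j+r_jt)$, for $J\subset\mathcal{A}$ long. Then: (a) the families (i) and (ii) together form a set of generators of the ideal $\bar K_+$; (b) the families (i) and (iii) together form a set of generators of the ideal $\bar K_-$.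
   Context: Cohomology has complex coefficients; $T=S^1$ and $H_T^*(\mathrm{point})=\mathbb{C}[t]$. The circle acts on each sphere $S^2_{r_j}\subset\mathbb{R}^3$ of radius $r_j$ (centered at the origin) by rotation about the $z$-axis, with moment map $\mu_j(x,y,z)=z$ with respect to the invariant symplectic form $x_j$. The forms $x_j$ and functions $\mu_j$ are pulled back to $M$ by the projections. The moment map of the diagonal action on $M$ is $\mu=\sum_{j=1}^m\mu_j$. Let $\tilde x_j=x_j+t\mu_j$ be the equivariant extension of $x_j$, defining a class in $H^2_T(M;\mathbb{C})$. For $J\subset\mathcal{A}=\{1,\ldots,m\}$ let $F_J=(i_1r_1\hat k,\ldots,i_mr_m\hat k)$, where $\hat k$ is the unit vector in the $z$-direction, $i_j=1$ if $j\in J$ and $i_j=-1$ if $j\notin J$. The points $F_J$ are exactly the fixed points. One has $\tilde x_j|_{F_J}=r_jt$ if $j\in J$ and $-r_jt$ if $j\notin J$, and $\mu(F_J)=\sum_{j\in J}r_j-\sum_{j\notin J}r_j$. Since $0$ is a regular value of $\mu$, $\mu(F_J)\neq0$ for all $J$. The subset $J$ is long if $\mu(F_J)>0$, and short otherwise. Let $K_+\subset H_T^*(M;\mathbb{C})$ (respectively $K_-$) be the ideal of classes whose restriction to every fixed point $p$ with $\mu(p)>0$ (respectively $\mu(p)<0$) vanishes. Let $\eta:\mathbb{C}[t,\tilde x_1,\ldots,\tilde x_m]\to H_T^*(M;\mathbb{C})$ be the ring homomorphism from the polynomial ring in $m+1$ variables sending each variable to the class of the same name. Then $\bar K_\pm=\eta^{-1}(K_\pm)$.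 *)

theory Defs
  imports "HOL-Analysis.Analysis" "HOL-Library.Poly_Mapping" "HOL-Algebra.QuotRing"
begin

section \<open>The algebra of differential forms on a Euclidean space\<close>

text \<open>
  An inhomogeneous complex form at a point is a function on lists of tangent vectors; its value on
  a list of length \<open>k\<close> is the value of its component of degree \<open>k\<close>.

  The wedge product is the usual signed sum over shuffles,
  \<open>(f \<and> g)(v\<^sub>1,\<dots>,v\<^sub>n) = \<Sum>\<^sub>S sgn(S) f(v\<^sub>S) g(v\<^sub>-\<^sub>S)\<close>, over all subsets \<open>S\<close> of the positions
  (no factorials).  It is written recursively, by distinguishing whether the first vector goes into
  the first or the second factor; equivalently, contraction is an antiderivation:
  \<open>\<iota>\<^sub>v (f \<and> g) = \<iota>\<^sub>v f \<and> g + f' \<and> \<iota>\<^sub>v g\<close>, where \<open>f' = (-1)\<^sup>k f\<close> in degree \<open>k\<close>.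
\<close>

fun wedge :: "('v list \<Rightarrow> 'c::comm_ring_1) \<Rightarrow> ('v list \<Rightarrow> 'c) \<Rightarrow> 'v list \<Rightarrow> 'c" where
  "wedge f g [] = f [] * g []"
| "wedge f g (v # vs) =
     wedge (\<lambda>ws. f (v # ws)) g vs + wedge (\<lambda>ws. (-1) ^ length ws * f ws) (\<lambda>ws. g (v # ws)) vs"

lemma wedge_add_left: "wedge (\<lambda>ws. f ws + f' ws) g vs = wedge f g vs + wedge f' g vs"
  by (induction vs arbitrary: f f' g) (simp_all add: algebra_simps)

lemma wedge_add_right: "wedge f (\<lambda>ws. g ws + g' ws) vs = wedge f g vs + wedge f g' vs"
  by (induction vs arbitrary: f g g') (simp_all add: algebra_simps)

lemma wedge_zero_left: "wedge (\<lambda>ws. 0) g vs = 0"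
  by (induction vs arbitrary: g) simp_all

lemma wedge_zero_right: "wedge f (\<lambda>ws. 0) vs = 0"
  by (induction vs arbitrary: f) simp_all

lemma wedge_scale_left: "wedge (\<lambda>ws. c * f ws) g vs = c * wedge f g vs"
proof (induction vs arbitrary: f g)
  case (Cons v vs)
  have "(\<lambda>ws. (-1) ^ length ws * (c * f ws)) = (\<lambda>ws. c * ((-1) ^ length ws * f ws))"
    by (simp add: algebra_simps)
  then show ?case
    using Cons[of "\<lambda>ws. f (v # ws)"] Cons[of "\<lambda>ws. (-1) ^ length ws * f ws"]
    by (simp add: algebra_simps)
qed (simp add: algebra_simps)

lemma wedge_parity:
  "(-1) ^ length vs * wedge f g vs =
   wedge (\<lambda>ws. (-1) ^ length ws * f ws) (\<lambda>ws. (-1) ^ length ws * g ws) vs"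
proof (induction vs arbitrary: f g)
  case (Cons v vs)
  let ?s = "\<lambda>h ws. (-1) ^ length ws * h ws"
  have l: "wedge (\<lambda>ws. - h ws) k vs = - wedge h k vs" for h k
    using wedge_scale_left[of "-1" h k vs] by simp
  have r: "wedge h (\<lambda>ws. - k ws) vs = - wedge h k vs" for h k
    using wedge_add_right[of h k "\<lambda>ws. - k ws" vs]
    by (simp add: wedge_zero_right add_eq_0_iff)
  have "(-1) ^ length (v # vs) * wedge f g (v # vs) =
      - wedge (?s (\<lambda>ws. f (v # ws))) (?s g) vs - wedge (?s (?s f)) (?s (\<lambda>ws. g (v # ws))) vs"
    by (simp only: Cons.IH[symmetric] wedge.simps) (simp add: algebra_simps)
  also have "\<dots> = wedge (?s f) (?s g) (v # vs)"
    by (simp add: l r)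
  finally show ?case .
qed simp

lemma wedge_assoc: "wedge (wedge f g) h vs = wedge f (wedge g h) vs"
proof (induction vs arbitrary: f g h)
  case (Cons v vs)
  have "(\<lambda>ws. (-1) ^ length ws * wedge f g ws) =
        wedge (\<lambda>ws. (-1) ^ length ws * f ws) (\<lambda>ws. (-1) ^ length ws * g ws)"
    by (rule ext) (rule wedge_parity)
  then show ?case
    by (simp add: wedge_add_left wedge_add_right Cons)
qed (simp add: algebra_simps)

lemma wedge_one_right: "wedge f (\<lambda>ws. if ws = [] then 1 else 0) vs = f vs"
  by (induction vs arbitrary: f) (simp_all add: wedge_zero_right)

lemma wedge_one_left:
  fixes g :: "'v list \<Rightarrow> 'c::comm_ring_1"
  shows "wedge (\<lambda>ws. if ws = [] then 1 else 0) g vs = g vs"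
proof (induction vs arbitrary: g)
  case (Cons v vs)
  have "(\<lambda>ws. (-1) ^ length ws * (if ws = [] then 1 else 0)) =
        (\<lambda>ws::'v list. if ws = [] then 1 else (0::'c))"
    by auto
  then show ?case by (simp add: wedge_zero_left Cons)
qed simp

typedef 'a form = "UNIV :: ('a \<Rightarrow> 'a list \<Rightarrow> complex) set"
  morphisms form_at Form ..

setup_lifting type_definition_form

instantiation form :: (type) ring_1
begin

lift_definition zero_form :: "'a form" is "\<lambda>p vs. 0" .
lift_definition one_form :: "'a form" is "\<lambda>p vs. if vs = [] then 1 else 0" .
lift_definition plus_form :: "'a form \<Rightarrow> 'a form \<Rightarrow> 'a form" is "\<lambda>\<omega> \<eta> p vs. \<omega> p vs + \<eta> p vs" .
lift_definition uminus_form :: "'a form \<Rightarrow> 'a form" is "\<lambda>\<omega> p vs. - \<omega> p vs" .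
lift_definition minus_form :: "'a form \<Rightarrow> 'a form \<Rightarrow> 'a form" is "\<lambda>\<omega> \<eta> p vs. \<omega> p vs - \<eta> p vs" .
lift_definition times_form :: "'a form \<Rightarrow> 'a form \<Rightarrow> 'a form" is "\<lambda>\<omega> \<eta> p. wedge (\<omega> p) (\<eta> p)" .

instance
proof
  fix a b c :: "'a form"
  show "a * b * c = a * (b * c)"
    by transfer (auto simp: fun_eq_iff wedge_assoc[abs_def])
  show "1 * a = a" by transfer (auto simp: fun_eq_iff wedge_one_left)
  show "a * 1 = a" by transfer (auto simp: fun_eq_iff wedge_one_right)
  show "(a + b) * c = a * c + b * c" by transfer (auto simp: fun_eq_iff wedge_add_left)
  show "a * (b + c) = a * b + a * c" by transfer (auto simp: fun_eq_iff wedge_add_right)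
  show "(0::'a form) \<noteq> 1"
    by transfer (metis zero_neq_one)
qed (transfer; auto simp: fun_eq_iff)+

end

lift_definition function_form :: "('a \<Rightarrow> complex) \<Rightarrow> 'a form" is
  "\<lambda>f p vs. if vs = [] then f p else 0" .

lift_definition two_form :: "('a \<Rightarrow> 'a \<Rightarrow> 'a \<Rightarrow> complex) \<Rightarrow> 'a form" is
  "\<lambda>\<sigma> p vs. case vs of [v, w] \<Rightarrow> \<sigma> p v w | _ \<Rightarrow> 0" .

lift_definition ext_deriv :: "'a::real_normed_vector form \<Rightarrow> 'a form" is
  "\<lambda>\<omega> p vs. \<Sum>i<length vs. (-1) ^ i *
     frechet_derivative (\<lambda>q. \<omega> q (take i vs @ drop (Suc i) vs)) (at p) (vs ! i)" .

lift_definition contract :: "('a \<Rightarrow> 'a) \<Rightarrow> 'a form \<Rightarrow> 'a form" is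
  "\<lambda>X \<omega> p vs. \<omega> p (X p # vs)" .

fun times_differentiable :: "nat \<Rightarrow> ('a::real_normed_vector \<Rightarrow> 'b::real_normed_vector) \<Rightarrow> bool" where
  "times_differentiable 0 f \<longleftrightarrow> continuous_on UNIV f"
| "times_differentiable (Suc n) f \<longleftrightarrow>
     (\<forall>p. f differentiable (at p)) \<and>
     (\<forall>v. times_differentiable n (\<lambda>p. frechet_derivative f (at p) v))"

definition smooth :: "('a::real_normed_vector \<Rightarrow> 'b::real_normed_vector) \<Rightarrow> bool" where
  "smooth f \<longleftrightarrow> (\<forall>n. times_differentiable n f)"

definition smooth_forms :: "'a::real_normed_vector form set" where
  "smooth_forms = {\<omega>.
     (\<forall>p us vs. linear (\<lambda>v. form_at \<omega> p (us @ v # vs))) \<and>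
     (\<forall>p vs. \<not> distinct vs \<longrightarrow> form_at \<omega> p vs = 0) \<and>
     (\<forall>vs. smooth (\<lambda>p. form_at \<omega> p vs))}"


section \<open>The product of spheres and the circle action\<close>

text \<open>\<open>M\<close> sits in the product of the copies of \<open>\<real>\<^sup>3\<close>, indexed by the finite type \<open>'n\<close>.\<close>

definition spheres :: "('n::finite \<Rightarrow> real) \<Rightarrow> (real^3^'n) set" where
  "spheres r = {p. \<forall>j. norm (p $ j) = r j}"

definition tangent :: "real^3^'n::finite \<Rightarrow> (real^3^'n) set" where
  "tangent p = {v. \<forall>j. p $ j \<bullet> v $ j = 0}"

definition rotz :: "real \<Rightarrow> real^3 \<Rightarrow> real^3" where
  "rotz \<theta> u = vector [cos \<theta> * u$1 - sin \<theta> * u$2, sin \<theta> * u$1 + cos \<theta> * u$2, u$3]"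

definition rotate_all :: "real \<Rightarrow> real^3^'n \<Rightarrow> real^3^'n::finite" where
  "rotate_all \<theta> p = (\<chi> j. rotz \<theta> (p $ j))"

definition fundamental_field :: "real^3^'n \<Rightarrow> real^3^'n::finite" where
  "fundamental_field p = vector_derivative (\<lambda>\<theta>. rotate_all \<theta> p) (at 0)"

definition fixed_points :: "('n::finite \<Rightarrow> real) \<Rightarrow> (real^3^'n) set" where
  "fixed_points r = {p \<in> spheres r. \<forall>\<theta>. rotate_all \<theta> p = p}"

definition height :: "'n::finite \<Rightarrow> real^3^'n \<Rightarrow> real" where
  "height j p = p $ j $ 3"

definition moment :: "real^3^'n::finite \<Rightarrow> real" where
  "moment p = (\<Sum>j\<in>UNIV. height j p)"

definition regular_value :: "('n::finite \<Rightarrow> real) \<Rightarrow> (real^3^'n \<Rightarrow> real) \<Rightarrow> real \<Rightarrow> bool" where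
  "regular_value r f c \<longleftrightarrow>
     (\<forall>p \<in> spheres r. f p = c \<longrightarrow> frechet_derivative f (at p) ` tangent p = UNIV)"

definition pole :: "('n::finite \<Rightarrow> real) \<Rightarrow> 'n set \<Rightarrow> real^3^'n" where
  "pole r J = (\<chi> j. (if j \<in> J then r j else - r j) *\<^sub>R axis 3 1)"

definition long :: "('n::finite \<Rightarrow> real) \<Rightarrow> 'n set \<Rightarrow> bool" where
  "long r J \<longleftrightarrow> moment (pole r J) > 0"

text \<open>
  The area form of the sphere of radius \<open>r\<close> is \<open>det(p,v,w) / r\<close>.  The invariant form \<open>\<omega>\<close> whose moment
  map is the height, in the convention \<open>\<iota>\<^sub>X \<omega> = d\<mu>\<close>, is the area form divided by \<open>r\<close>.
\<close>

definition sphere_form :: "('n::finite \<Rightarrow> real) \<Rightarrow> 'n \<Rightarrow> (real^3^'n) form" where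
  "sphere_form r j =
     two_form (\<lambda>p v w. complex_of_real (p $ j \<bullet> cross3 (v $ j) (w $ j) / (r j)\<^sup>2))"


section \<open>Equivariant cohomology (Cartan model)\<close>

text \<open>
  Since \<open>M\<close> is a closed submanifold, every smooth form on \<open>M\<close> is the restriction of a smooth form on
  the ambient space \<open>E\<close>, so \<open>\<Omega>(M)\<close> is the quotient of \<open>\<Omega>(E)\<close> by the forms whose pullback to \<open>M\<close>
  vanishes, and \<open>d\<close> and \<open>\<iota>\<^sub>X\<close> on \<open>M\<close> may be computed on \<open>E\<close> (\<open>X\<close> being tangent to \<open>M\<close>).  We therefore
  represent elements of \<open>\<Omega>(M)[t]\<close> by elements of \<open>\<Omega>(E)[t]\<close>; the latter are the finitely supported
  functions \<open>nat \<Rightarrow>\<^sub>0 form\<close> with the convolution product, and \<open>t\<close> is \<open>Poly_Mapping.single 1 1\<close>.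
\<close>

type_synonym 'n tform = "nat \<Rightarrow>\<^sub>0 (real^3^'n) form"

definition vanishes_on :: "('n::finite \<Rightarrow> real) \<Rightarrow> 'n tform \<Rightarrow> bool" where
  "vanishes_on r \<alpha> \<longleftrightarrow>
     (\<forall>k. \<forall>p \<in> spheres r. \<forall>vs. set vs \<subseteq> tangent p \<longrightarrow> form_at (Poly_Mapping.lookup \<alpha> k) p vs = 0)"

definition cartan_forms :: "('n::finite \<Rightarrow> real) \<Rightarrow> 'n tform set" where
  "cartan_forms r = {\<alpha>.
     (\<forall>k. Poly_Mapping.lookup \<alpha> k \<in> smooth_forms) \<and>
     (\<forall>k \<theta>. \<forall>p \<in> spheres r. \<forall>vs. set vs \<subseteq> tangent p \<longrightarrow>
        form_at (Poly_Mapping.lookup \<alpha> k) (rotate_all \<theta> p) (map (rotate_all \<theta>) vs) =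
        form_at (Poly_Mapping.lookup \<alpha> k) p vs)}"

text \<open>\<open>d\<^sub>T = d - t \<iota>\<^sub>X\<close>; the sign is the one for which \<open>x\<^sub>j + t \<mu>\<^sub>j\<close> is closed.\<close>

definition cartan_d :: "'n tform \<Rightarrow> 'n::finite tform" where
  "cartan_d \<alpha> = Poly_Mapping.map ext_deriv \<alpha> -
     Poly_Mapping.single 1 1 * Poly_Mapping.map (contract fundamental_field) \<alpha>"

definition cocycles :: "('n::finite \<Rightarrow> real) \<Rightarrow> 'n tform set" where
  "cocycles r = {\<alpha> \<in> cartan_forms r. vanishes_on r (cartan_d \<alpha>)}"

text \<open>Cocycles that are exact on \<open>M\<close>; in particular all cocycles vanishing on \<open>M\<close>.\<close>

definition coboundaries :: "('n::finite \<Rightarrow> real) \<Rightarrow> 'n tform set" where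
  "coboundaries r = {\<alpha> \<in> cocycles r. \<exists>\<beta> \<in> cartan_forms r. vanishes_on r (\<alpha> - cartan_d \<beta>)}"

definition ring_on :: "'a::ring_1 set \<Rightarrow> 'a ring" where
  "ring_on S = \<lparr>carrier = S, mult = (*), one = 1, zero = 0, add = (+)\<rparr>"

definition HT :: "('n::finite \<Rightarrow> real) \<Rightarrow> 'n tform set ring" where
  "HT r = ring_on (cocycles r) Quot coboundaries r"

definition cohomology_class :: "('n::finite \<Rightarrow> real) \<Rightarrow> 'n tform \<Rightarrow> 'n tform set" where
  "cohomology_class r \<alpha> = coboundaries r +>\<^bsub>ring_on (cocycles r)\<^esub> \<alpha>"

text \<open>
  Pullback to a point takes values in \<open>\<complex>[t]\<close>, the equivariant cohomology of a point; on classes it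
  is the common value of all representatives.
\<close>

definition pull_point :: "real^3^'n \<Rightarrow> 'n::finite tform \<Rightarrow> complex poly" where
  "pull_point p \<alpha> = (\<Sum>k \<in> Poly_Mapping.keys \<alpha>. monom (form_at (Poly_Mapping.lookup \<alpha> k) p []) k)"

definition restrict_class :: "real^3^'n \<Rightarrow> 'n::finite tform set \<Rightarrow> complex poly" where
  "restrict_class p c = the_elem (pull_point p ` c)"

definition K_plus :: "('n::finite \<Rightarrow> real) \<Rightarrow> 'n tform set set" where
  "K_plus r = {c \<in> carrier (HT r). \<forall>p \<in> fixed_points r. moment p > 0 \<longrightarrow> restrict_class p c = 0}"

definition K_minus :: "('n::finite \<Rightarrow> real) \<Rightarrow> 'n tform set set" where
  "K_minus r = {c \<in> carrier (HT r). \<forall>p \<in> fixed_points r. moment p < 0 \<longrightarrow> restrict_class p c = 0}"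

definition x_tilde :: "('n::finite \<Rightarrow> real) \<Rightarrow> 'n \<Rightarrow> 'n tform" where
  "x_tilde r j = Poly_Mapping.single 0 (sphere_form r j) +
     Poly_Mapping.single 1 1 * Poly_Mapping.single 0 (function_form (\<lambda>p. complex_of_real (height j p)))"


section \<open>The polynomial ring and the ideals\<close>

text \<open>
  Polynomials with complex coefficients in the variables \<open>t\<close> (index \<open>None\<close>) and \<open>x\<^sub>j\<close> (index
  \<open>Some j\<close>): a monomial is an exponent function \<open>'n option \<Rightarrow>\<^sub>0 nat\<close>.
\<close>

type_synonym 'n tpoly = "('n option \<Rightarrow>\<^sub>0 nat) \<Rightarrow>\<^sub>0 complex"

definition const_poly :: "complex \<Rightarrow> 'n tpoly" where
  "const_poly c = Poly_Mapping.single 0 c"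

definition var_t :: "'n tpoly" where
  "var_t = Poly_Mapping.single (Poly_Mapping.single None 1) 1"

definition var_x :: "'n \<Rightarrow> 'n tpoly" where
  "var_x j = Poly_Mapping.single (Poly_Mapping.single (Some j) 1) 1"

abbreviation poly_ring :: "'n tpoly ring" where
  "poly_ring \<equiv> ring_on UNIV"

text \<open>
  Substitution of \<open>t\<close> and the even-degree (hence commuting) cocycles \<open>x_tilde r j\<close>; the linear order
  on \<open>'n\<close> only serves to write down the product in an algebra that is not commutative as a whole.
\<close>

definition substitute :: "('n::{finite,linorder} \<Rightarrow> real) \<Rightarrow> 'n tpoly \<Rightarrow> 'n tform" where
  "substitute r f = (\<Sum>a \<in> Poly_Mapping.keys f.
     Poly_Mapping.single 0 (function_form (\<lambda>p. Poly_Mapping.lookup f a)) *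
     Poly_Mapping.single 1 1 ^ Poly_Mapping.lookup a None *
     prod_list (map (\<lambda>j. x_tilde r j ^ Poly_Mapping.lookup a (Some j)) (sorted_list_of_set UNIV)))"

definition eta :: "('n::{finite,linorder} \<Rightarrow> real) \<Rightarrow> 'n tpoly \<Rightarrow> 'n tform set" where
  "eta r f = cohomology_class r (substitute r f)"

definition Kbar_plus :: "('n::{finite,linorder} \<Rightarrow> real) \<Rightarrow> 'n tpoly set" where
  "Kbar_plus r = eta r -` K_plus r"

definition Kbar_minus :: "('n::{finite,linorder} \<Rightarrow> real) \<Rightarrow> 'n tpoly set" where
  "Kbar_minus r = eta r -` K_minus r"

definition family_i :: "('n \<Rightarrow> real) \<Rightarrow> 'n tpoly set" where
  "family_i r =
     {(var_x j - const_poly (r j) * var_t) * (var_x j + const_poly (r j) * var_t) | j. True}"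

definition P_poly :: "('n::finite \<Rightarrow> real) \<Rightarrow> 'n set \<Rightarrow> 'n tpoly" where
  "P_poly r J = (\<Prod>j\<in>J. var_x j - const_poly (r j) * var_t)"

definition Q_poly :: "('n::finite \<Rightarrow> real) \<Rightarrow> 'n set \<Rightarrow> 'n tpoly" where
  "Q_poly r J = (\<Prod>j\<in>J. var_x j + const_poly (r j) * var_t)"

end

theory Submission
  imports Defs
begin

text \<open>
  The fixed points are the poles, and restricting \<open>\<eta>(f)\<close> to the pole \<open>F\<^sub>J\<close> substitutes \<open>\<plusminus>r\<^sub>j t\<close> for
  \<open>x\<^sub>j\<close>.  So \<open>\<eta>\<^sup>-\<^sup>1(K\<^sub>+)\<close> consists of the polynomials vanishing at the vertices indexed by long
  sets.  Modulo the family (i), every polynomial is a \<open>\<complex>[t]\<close>-linear combination of the \<open>P\<^sub>J\<close>, and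
  \<open>P\<^sub>J\<close> vanishes at the vertex \<open>S\<close> unless \<open>J\<close> and \<open>S\<close> are disjoint.  Since two long sets always
  meet, the long \<open>P\<^sub>J\<close> vanish at all long vertices; conversely, evaluating at the complements of the
  short sets, by induction on inclusion, kills the coefficients of the short \<open>P\<^sub>J\<close>.  The statement
  for \<open>K\<^sub>-\<close> is the same one with \<open>r\<close> replaced by \<open>-r\<close>.
\<close>

section \<open>The ideal of a set of vertices of a cube\<close>

text \<open>The ring \<open>HT r\<close> is never computed. Membership in \<open>K_plus\<close> and
  \<open>K_minus\<close> is tested by restriction to fixed points, so two facts about the Cartan
  model suffice: substituted polynomials are cocycles, and coboundaries restrict to zero at a fixed
  point. The labour lies in the first. A \<open>form\<close> is an arbitrary function on lists of
  vectors, in a noncommutative algebra, so smoothness, multilinearity and alternation have to be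
  carried through products, and the Leibniz rule comes with signs. The factors that occur on the
  left are all of even degree, which removes the signs. Regularity of 0 enters through the poles:
  they are critical points of the moment map, so the moment is nonzero there, and exactly one of a
  set and its complement is long. Together with upward closure this is all that the polynomial
  algebra uses of longness, so the same family of long sets can be paired with the radii
  \<open>r\<close> and with \<open>-r\<close>.\<close>

lemma poly_mapping_additive_induct [case_names zero_mem coeff zero add single]:
  fixes \<alpha> :: "'k \<Rightarrow>\<^sub>0 'c::comm_monoid_add"
  assumes "0 \<in> S" and "\<And>k. Poly_Mapping.lookup \<alpha> k \<in> S" and "P 0"
    and "\<And>\<beta> \<gamma>. \<lbrakk>\<And>k. Poly_Mapping.lookup \<beta> k \<in> S; \<And>k. Poly_Mapping.lookup \<gamma> k \<in> S; P \<beta>; P \<gamma>\<rbrakk> \<Longrightarrow> P (\<beta> + \<gamma>)"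
    and "\<And>k c. c \<in> S \<Longrightarrow> P (Poly_Mapping.single k c)"
  shows "P \<alpha>"
  using assms(2)
proof (induction \<alpha> rule: update_induct)
  case const
  show ?case using assms(3) .
next
  case (update \<alpha> k c)
  have k: "Poly_Mapping.lookup \<alpha> k = 0" using update.hyps(1) by (simp add: in_keys_iff)
  have e: "Poly_Mapping.update k c \<alpha> = \<alpha> + Poly_Mapping.single k c"
    by (rule poly_mapping_eqI) (auto simp: lookup_update lookup_add lookup_single k when_def)
  have c: "c \<in> S" using update.prems[of k] by (simp add: lookup_update)
  have "Poly_Mapping.lookup \<alpha> i \<in> S" for i
    using update.prems[of i] k assms(1) by (auto simp: lookup_update split: if_splits)
  with assms(1) c update.IH show ?case
    unfolding e by (intro assms(4,5)) (auto simp: lookup_single when_def)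
qed

lemma poly_mapping_single_induct [case_names zero add single]:
  fixes \<alpha> :: "'k \<Rightarrow>\<^sub>0 'c::comm_monoid_add"
  assumes "P 0" and "\<And>\<beta> \<gamma>. \<lbrakk>P \<beta>; P \<gamma>\<rbrakk> \<Longrightarrow> P (\<beta> + \<gamma>)"
    and "\<And>k c. P (Poly_Mapping.single k c)"
  shows "P \<alpha>"
  by (rule poly_mapping_additive_induct[where S = UNIV]) (use assms in auto)

section \<open>Evaluation of polynomials with values in C[t]\<close>

definition monomial_value :: "('n::finite \<Rightarrow> complex) \<Rightarrow> ('n option \<Rightarrow>\<^sub>0 nat) \<Rightarrow> complex poly" where
  "monomial_value s a = monom 1 1 ^ Poly_Mapping.lookup a None *
     (\<Prod>j\<in>UNIV. monom (s j) 1 ^ Poly_Mapping.lookup a (Some j))"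

text \<open>The C-algebra homomorphism to C[t] that fixes t and sends x_j to s_j t. For suitable
  \<open>s\<close> it is \<open>eta\<close> followed by restriction to a pole.\<close>

definition value_at :: "('n::finite \<Rightarrow> complex) \<Rightarrow> 'n tpoly \<Rightarrow> complex poly" where
  "value_at s f = (\<Sum>a\<in>Poly_Mapping.keys f. [:Poly_Mapping.lookup f a:] * monomial_value s a)"

lemma monomial_value_add: "monomial_value s (a + b) = monomial_value s a * monomial_value s b"
  by (simp add: monomial_value_def lookup_add power_add prod.distrib mult_ac)

lemma value_at_superset:
  assumes "finite A" "Poly_Mapping.keys f \<subseteq> A"
  shows "value_at s f = (\<Sum>a\<in>A. [:Poly_Mapping.lookup f a:] * monomial_value s a)"
  unfolding value_at_def using assms
  by (intro sum.mono_neutral_left) (auto simp: in_keys_iff)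

lemma value_at_zero [simp]: "value_at s 0 = 0"
  by (simp add: value_at_def)

lemma value_at_single [simp]: "value_at s (Poly_Mapping.single a c) = [:c:] * monomial_value s a"
  by (subst value_at_superset[of "{a}"]) auto

lemma value_at_add [simp]: "value_at s (f + g) = value_at s f + value_at s g"
proof -
  let ?A = "Poly_Mapping.keys f \<union> Poly_Mapping.keys g"
  have "value_at s (f + g) = (\<Sum>a\<in>?A. [:Poly_Mapping.lookup (f + g) a:] * monomial_value s a)"
    by (rule value_at_superset) (use Poly_Mapping.keys_add[of f g] in auto)
  also have "\<dots> = (\<Sum>a\<in>?A. [:Poly_Mapping.lookup f a:] * monomial_value s a) +
                 (\<Sum>a\<in>?A. [:Poly_Mapping.lookup g a:] * monomial_value s a)"
    by (simp add: lookup_add sum.distrib[symmetric] smult_add_left)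
  also have "\<dots> = value_at s f + value_at s g"
    by (subst (1 2) value_at_superset[of ?A]) auto
  finally show ?thesis .
qed

lemma value_at_mult [simp]: "value_at s (f * g) = value_at s f * value_at s g"
proof (induction f rule: poly_mapping_single_induct)
  case (single a c)
  show ?case
    by (induction g rule: poly_mapping_single_induct)
      (simp_all add: distrib_left smult_add_right mult_single monomial_value_add algebra_simps)
qed (simp_all add: distrib_right)

lemma value_at_uminus [simp]: "value_at s (- f) = - value_at s f"
  using value_at_add[of s f "- f"] by (simp add: eq_neg_iff_add_eq_0 add.commute del: value_at_add)

lemma value_at_diff [simp]: "value_at s (f - g) = value_at s f - value_at s g"
  using value_at_add[of s f "- g"] by (simp del: value_at_add)

lemma value_at_const_poly [simp]: "value_at s (const_poly c) = [:c:]"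
  by (simp add: const_poly_def monomial_value_def)

lemma value_at_one [simp]: "value_at s 1 = 1"
  using value_at_const_poly[of s 1] by (simp add: const_poly_def)

lemma value_at_var_t [simp]: "value_at s var_t = monom 1 1"
  by (simp add: var_t_def monomial_value_def lookup_single)

lemma value_at_var_x [simp]: "value_at s (var_x j) = monom (s j) 1"
proof -
  have "(\<Prod>i\<in>UNIV. monom (s i) 1 ^ Poly_Mapping.lookup (Poly_Mapping.single (Some j) 1) (Some i)) =
        (\<Prod>i\<in>UNIV. if i = j then monom (s j) 1 else 1)"
    by (rule prod.cong) (auto simp: lookup_single when_def)
  then show ?thesis
    by (simp add: var_x_def monomial_value_def lookup_single)
qed

lemma value_at_sum [simp]: "value_at s (sum f A) = (\<Sum>i\<in>A. value_at s (f i))"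
  by (induction A rule: infinite_finite_induct) simp_all

lemma value_at_prod [simp]: "value_at s (prod f A) = (\<Prod>i\<in>A. value_at s (f i))"
  by (induction A rule: infinite_finite_induct) simp_all

section \<open>Ideals of a commutative ring presented as a record\<close>

lemma cring_ring_on_UNIV: "cring (ring_on (UNIV :: 'a::comm_ring_1 set))"
  by (intro cringI abelian_groupI comm_monoidI)
    (auto simp: ring_on_def algebra_simps intro: exI[of _ "- x" for x])

lemma ideal_ring_onD:
  assumes "ideal I (ring_on (UNIV :: 'a::comm_ring_1 set))"
  shows "0 \<in> I" and "a \<in> I \<Longrightarrow> b \<in> I \<Longrightarrow> a + b \<in> I" and "a \<in> I \<Longrightarrow> c * a \<in> I"
  using additive_subgroup.zero_closed[OF ideal.axioms(1)[OF assms]]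
    additive_subgroup.a_closed[OF ideal.axioms(1)[OF assms], of a b]
    ideal.I_l_closed[OF assms, of a c]
  by (auto simp: ring_on_def)

lemma ideal_ring_onI:
  fixes I :: "'a::comm_ring_1 set"
  assumes "0 \<in> I" and "\<And>a b. a \<in> I \<Longrightarrow> b \<in> I \<Longrightarrow> a + b \<in> I" and "\<And>a c. a \<in> I \<Longrightarrow> c * a \<in> I"
  shows "ideal I (ring_on UNIV)"
proof -
  interpret R: cring "ring_on (UNIV :: 'a set)" by (rule cring_ring_on_UNIV)
  \<comment> \<open>The record knows negation only as inversion in its additive monoid; once this is
    \<open>- a\<close>, closure under it is multiplication by -1.\<close>
  have inv: "inv\<^bsub>add_monoid (ring_on UNIV)\<^esub> a = - a" for a :: 'a
    using R.minus_equality[of "- a" a] by (simp add: ring_on_def a_inv_def)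
  show ?thesis
  proof (rule idealI[OF R.ring_axioms])
    show "subgroup I (add_monoid (ring_on UNIV))"
    proof
      show "inv\<^bsub>add_monoid (ring_on UNIV)\<^esub> a \<in> I" if "a \<in> I" for a
        unfolding inv using assms(3)[OF that, of "-1"] by simp
    qed (use assms in \<open>auto simp: ring_on_def\<close>)
  qed (use assms(3) in \<open>auto simp: ring_on_def mult.commute\<close>)
qed

text \<open>The inclusion of C[t], as a Horner scheme in \<open>var_t\<close>. It is a section of
  every \<open>value_at s\<close>, so coefficients reappear unchanged after evaluation.\<close>

definition poly_in_t :: "complex poly \<Rightarrow> 'n tpoly" where
  "poly_in_t p = fold_coeffs (\<lambda>c f. const_poly c + var_t * f) p 0"

lemma const_poly_0 [simp]: "const_poly 0 = 0"
  by (simp add: const_poly_def)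

lemma const_poly_add: "const_poly (a + b) = const_poly a + const_poly b"
  by (simp add: const_poly_def single_add)

lemma const_poly_uminus: "const_poly (- a) = - const_poly a"
  by (simp add: const_poly_def single_uminus)

lemma const_poly_mult: "const_poly (a * b) = const_poly a * const_poly b"
  by (simp add: const_poly_def mult_single)

lemma poly_in_t_0 [simp]: "poly_in_t 0 = 0"
  by (simp add: poly_in_t_def)

lemma poly_in_t_pCons [simp]: "poly_in_t (pCons c p) = const_poly c + var_t * poly_in_t p"
  by (cases "c = 0 \<and> p = 0") (auto simp: poly_in_t_def)

lemma poly_in_t_add [simp]: "poly_in_t (p + q) = poly_in_t p + poly_in_t q"
  by (induction p q rule: poly_induct2) (simp_all add: const_poly_add algebra_simps)

lemma poly_in_t_smult [simp]: "poly_in_t (smult c p) = const_poly c * poly_in_t p"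
  by (induction p) (simp_all add: const_poly_mult algebra_simps)

lemma poly_in_t_mult [simp]: "poly_in_t (p * q) = poly_in_t p * poly_in_t q"
  by (induction p) (simp_all add: algebra_simps)

lemma poly_in_t_const [simp]: "poly_in_t [:c:] = const_poly c"
  by simp

lemma poly_in_t_monom1 [simp]: "poly_in_t (monom 1 (Suc 0)) = var_t"
  by (simp add: monom_Suc monom_0 const_poly_def)

lemma poly_in_t_monom: "poly_in_t (monom c (Suc 0)) = const_poly c * var_t"
  by (simp add: monom_Suc monom_0 mult.commute)

lemma value_at_poly_in_t [simp]: "value_at s (poly_in_t p) = p"
  by (induction p) (simp_all add: monom_altdef)

section \<open>Vertices of the cube and the products \<open>P_poly r J\<close>\<close>

definition vertex :: "('n \<Rightarrow> real) \<Rightarrow> 'n set \<Rightarrow> 'n \<Rightarrow> complex" where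
  "vertex r S j = complex_of_real (if j \<in> S then r j else - r j)"

lemma value_at_P_poly:
  "value_at (vertex r S) (P_poly r J) = (\<Prod>j\<in>J. if j \<in> S then 0 else monom (- 2 * r j) 1)"
  unfolding P_poly_def value_at_prod
  by (rule prod.cong) (auto simp: vertex_def smult_monom diff_monom)

text \<open>At S the factor of index j vanishes exactly for j in S; every other factor is -2 r_j t,
  and C[t] is a domain.\<close>

lemma value_at_P_poly_eq_0_iff:
  assumes "\<And>j. r j \<noteq> 0"
  shows "value_at (vertex r S) (P_poly r J) = 0 \<longleftrightarrow> J \<inter> S \<noteq> {}"
  using assms by (auto simp: value_at_P_poly)

lemma value_at_family_i:
  assumes "f \<in> family_i r"
  shows "value_at (vertex r S) f = 0"
  using assms by (auto simp: family_i_def vertex_def smult_monom add_monom)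

text \<open>Modulo (i), the C[t]-span of the P_J is stable under each x_j: for j outside J, x_j P_J
  is the product for J with j added plus r_j t P_J, and for j in J the relation (i) gives x_j P_J =
  -r_j t P_J. The span contains 1, the empty product, hence everything. The ideal is left arbitrary
  so that the generated ideal can be inserted.\<close>

lemma span_P_poly:
  fixes r :: "'n::finite \<Rightarrow> real"
  assumes I: "ideal I (ring_on UNIV)" "family_i r \<subseteq> I"
  shows "\<exists>c. f - (\<Sum>J\<in>UNIV. poly_in_t (c J) * P_poly r J) \<in> I"
proof -
  note D = ideal_ring_onD[OF I(1)]
  define span where "span = {f. \<exists>c. f - (\<Sum>J\<in>UNIV. poly_in_t (c J) * P_poly r J) \<in> I}"
  have span_add: "f + g \<in> span" if fg: "f \<in> span" "g \<in> span" for f g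
  proof -
    obtain c d where "f - (\<Sum>J\<in>UNIV. poly_in_t (c J) * P_poly r J) \<in> I"
      "g - (\<Sum>J\<in>UNIV. poly_in_t (d J) * P_poly r J) \<in> I"
      using fg by (auto simp: span_def)
    from D(2)[OF this] have "f + g - (\<Sum>J\<in>UNIV. poly_in_t (c J + d J) * P_poly r J) \<in> I"
      by (simp add: algebra_simps sum.distrib)
    then show ?thesis unfolding span_def by (intro CollectI exI)
  qed
  have sum: "(\<Sum>i\<in>A. g i) \<in> span" if "\<And>i. i \<in> A \<Longrightarrow> g i \<in> span" "finite A" for A and g :: "'i \<Rightarrow> 'n tpoly"
    using that(2,1)
  proof (induction A)
    case empty
    have "0 - (\<Sum>J\<in>UNIV. poly_in_t 0 * P_poly r J) \<in> I" using D(1) by simp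
    then show ?case by (auto simp: span_def intro!: exI[of _ "\<lambda>_. 0"])
  qed (auto intro: span_add)
  have mult: "poly_in_t p * f \<in> span" if f: "f \<in> span" for p f
  proof -
    obtain c where "f - (\<Sum>J\<in>UNIV. poly_in_t (c J) * P_poly r J) \<in> I"
      using f by (auto simp: span_def)
    from D(3)[OF this, of "poly_in_t p"]
    have "poly_in_t p * f - (\<Sum>J\<in>UNIV. poly_in_t (p * c J) * P_poly r J) \<in> I"
      by (simp add: algebra_simps sum_distrib_left)
    then show ?thesis unfolding span_def by (intro CollectI exI)
  qed
  have P: "P_poly r J \<in> span" for J
  proof -
    have "(\<Sum>K\<in>UNIV. poly_in_t (if K = J then 1 else 0) * P_poly r K) = P_poly r J"
      by (subst sum.remove[of _ J]) (simp_all add: one_pCons const_poly_def del: poly_in_t_pCons)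
    then show ?thesis
      using D(1) by (auto simp: span_def intro!: exI[of _ "\<lambda>K. if K = J then 1 else 0"])
  qed
  have ideal: "f \<in> span" if "f \<in> I" for f
    using that by (auto simp: span_def intro!: exI[of _ "\<lambda>_. 0"])
  have xP: "var_x j * P_poly r J \<in> span" for j J
  proof (cases "j \<in> J")
    case False
    then have "var_x j * P_poly r J = P_poly r (insert j J) + poly_in_t (monom (r j) 1) * P_poly r J"
      by (simp add: P_poly_def poly_in_t_monom algebra_simps)
    then show ?thesis using span_add[OF P mult[OF P]] by metis
  next
    case True
    let ?p = "(var_x j - const_poly (r j) * var_t) * (var_x j + const_poly (r j) * var_t)"
    have P_J: "P_poly r J = (var_x j - const_poly (r j) * var_t) * P_poly r (J - {j})"
      using True by (simp add: P_poly_def prod.remove)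
    have "var_x j * P_poly r J = P_poly r (J - {j}) * ?p + poly_in_t (monom (- r j) 1) * P_poly r J"
      unfolding P_J by (simp add: poly_in_t_monom const_poly_uminus algebra_simps)
    moreover have "?p \<in> I" using I(2) by (auto simp: family_i_def)
    ultimately show ?thesis using span_add[OF ideal[OF D(3)] mult[OF P]] by metis
  qed
  have x: "var_x j * f \<in> span" if f: "f \<in> span" for j f
  proof -
    obtain c where c: "f - (\<Sum>J\<in>UNIV. poly_in_t (c J) * P_poly r J) \<in> I"
      using f by (auto simp: span_def)
    have "var_x j * f = var_x j * (f - (\<Sum>J\<in>UNIV. poly_in_t (c J) * P_poly r J)) +
        (\<Sum>J\<in>UNIV. poly_in_t (c J) * (var_x j * P_poly r J))"
      by (simp add: algebra_simps sum_distrib_left)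
    also have "\<dots> \<in> span"
      using c by (intro span_add ideal D(3) sum mult xP) auto
    finally show ?thesis .
  qed
  have one: "1 \<in> span" using P[of "{}"] by (simp add: P_poly_def)
  have "f \<in> span"
  proof (induction f rule: poly_mapping_single_induct)
    case zero show ?case using ideal D(1) .
  next
    case (add f g) then show ?case using span_add by blast
  next
    case (single a c)
    \<comment> \<open>Multiplication by a monomial preserves the span. The induction is on the
      exponent function, and \<open>f\<close> varies because a product of monomials acts one factor
      after the other.\<close>
    have "Poly_Mapping.single a 1 * f \<in> span" if "f \<in> span" for f
      using that
    proof (induction a arbitrary: f rule: poly_mapping_single_induct)
      case zero then show ?case by simp
    next
      case (add a b)
      have "Poly_Mapping.single (a + b) 1 * f = Poly_Mapping.single a 1 * (Poly_Mapping.single b 1 * f)"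
        by (simp add: mult_single flip: mult.assoc)
      with add show ?case by simp
    next
      case (single v n)
      show ?case
      proof (induction n)
        case 0 with single show ?case by simp
      next
        case (Suc n)
        have "Poly_Mapping.single v (Suc n) = Poly_Mapping.single v 1 + Poly_Mapping.single v n"
          by (simp flip: single_add)
        then have "Poly_Mapping.single (Poly_Mapping.single v (Suc n)) 1 * f =
            Poly_Mapping.single (Poly_Mapping.single v 1) 1 * (Poly_Mapping.single (Poly_Mapping.single v n) 1 * f)"
          by (simp add: mult_single flip: mult.assoc)
        \<comment> \<open>\<open>None\<close> is multiplication by the scalar t,
          \<open>Some j\<close> multiplication by x_j.\<close>
        with Suc mult[of _ "monom 1 1"] x show ?case
          by (cases v) (auto simp: var_x_def var_t_def)
      qed
    qed
    from this[OF one] have "Poly_Mapping.single a 1 \<in> span" by simp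
    from mult[OF this, of "[:c:]"] show ?case by (simp add: const_poly_def mult_single)
  qed
  then show ?thesis by (simp add: span_def)
qed

text \<open>The hypotheses say that \<open>L\<close> is a maximal intersecting family. They mention
  neither the moment map nor the sign of the radii, so that negated radii can be combined with the
  long sets of the original ones.\<close>

theorem vanishing_ideal:
  fixes r :: "'n::finite \<Rightarrow> real"
  assumes r: "\<And>j. r j \<noteq> 0"
    and up: "\<And>J K. J \<in> L \<Longrightarrow> J \<subseteq> K \<Longrightarrow> K \<in> L"
    and compl: "\<And>J. - J \<in> L \<longleftrightarrow> J \<notin> L"
  shows "{f. \<forall>S\<in>L. value_at (vertex r S) f = 0} = Idl\<^bsub>poly_ring\<^esub> (family_i r \<union> {P_poly r J | J. J \<in> L})"
    (is "?V = Idl\<^bsub>_\<^esub> ?G")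
proof
  interpret R: cring "poly_ring :: 'n tpoly ring" by (rule cring_ring_on_UNIV)
  have V: "ideal ?V poly_ring"
    by (rule ideal_ring_onI) auto
  \<comment> \<open>If J and S were disjoint, J would be contained in \<open>- S\<close>, so that
    both S and its complement would lie in \<open>L\<close>.\<close>
  have "J \<inter> S \<noteq> {}" if "J \<in> L" "S \<in> L" for J S
    using up[OF \<open>J \<in> L\<close>, of "- S"] compl[of S] that by auto
  then have GV: "?G \<subseteq> ?V"
    by (auto simp: value_at_family_i value_at_P_poly_eq_0_iff[OF r])
  show "Idl\<^bsub>poly_ring\<^esub> ?G \<subseteq> ?V"
    by (rule R.genideal_minimal[OF V GV])
  have I: "ideal (Idl\<^bsub>poly_ring\<^esub> ?G) poly_ring" and G: "?G \<subseteq> Idl\<^bsub>poly_ring\<^esub> ?G"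
    by (rule R.genideal_ideal R.genideal_self, simp add: ring_on_def)+
  note D = ideal_ring_onD[OF I]
  have sum: "(\<Sum>i\<in>A. g i) \<in> Idl\<^bsub>poly_ring\<^esub> ?G" if "\<And>i. i \<in> A \<Longrightarrow> g i \<in> Idl\<^bsub>poly_ring\<^esub> ?G"
    for A :: "'n set set" and g
    using that by (induction A rule: infinite_finite_induct) (auto intro: D)
  show "?V \<subseteq> Idl\<^bsub>poly_ring\<^esub> ?G"
  proof
    fix f assume f: "f \<in> ?V"
    obtain c where c: "f - (\<Sum>J\<in>UNIV. poly_in_t (c J) * P_poly r J) \<in> Idl\<^bsub>poly_ring\<^esub> ?G"
      using span_P_poly[OF I, of r f] G by auto
    have long: "(\<Sum>J\<in>L. poly_in_t (c J) * P_poly r J) \<in> Idl\<^bsub>poly_ring\<^esub> ?G"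
      by (intro sum D(3)) (use G in blast)
    have split: "(\<Sum>J\<in>UNIV. poly_in_t (c J) * P_poly r J) =
        (\<Sum>J\<in>L. poly_in_t (c J) * P_poly r J) + (\<Sum>J\<in>-L. poly_in_t (c J) * P_poly r J)"
      by (subst sum.union_disjoint[symmetric]) auto
    have eq: "f - (\<Sum>J\<in>-L. poly_in_t (c J) * P_poly r J) =
        f - (\<Sum>J\<in>UNIV. poly_in_t (c J) * P_poly r J) + (\<Sum>J\<in>L. poly_in_t (c J) * P_poly r J)"
      unfolding split by simp
    have g: "f - (\<Sum>J\<in>-L. poly_in_t (c J) * P_poly r J) \<in> Idl\<^bsub>poly_ring\<^esub> ?G"
      unfolding eq using c long by (rule D(2))
    \<comment> \<open>Members of the generated ideal vanish on \<open>L\<close>, and so does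
      \<open>f\<close>; hence the combination of the remaining products vanishes there.\<close>
    then have "f - (\<Sum>J\<in>-L. poly_in_t (c J) * P_poly r J) \<in> ?V"
      using \<open>Idl\<^bsub>poly_ring\<^esub> ?G \<subseteq> ?V\<close> by blast
    then have v: "(\<Sum>J\<in>-L. c J * value_at (vertex r S) (P_poly r J)) = 0" if "S \<in> L" for S
      using f that by auto
    \<comment> \<open>Evaluating at the vertex \<open>- J\<close> leaves only the terms indexed by subsets of \<open>J\<close>.\<close>
    have "c J = 0" if "J \<notin> L" for J
      using finite[of J] that
    proof (induction J rule: finite_psubset_induct)
      case (psubset J)
      have "(\<Sum>K\<in>-L. c K * value_at (vertex r (- J)) (P_poly r K)) =
            c J * value_at (vertex r (- J)) (P_poly r J)"
      proof (subst sum.remove[of _ J])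
        have "c K * value_at (vertex r (- J)) (P_poly r K) = 0" if "K \<in> - L - {J}" for K
        proof (cases "K \<subseteq> J")
          case True
          with that psubset.IH[of K] show ?thesis by auto
        next
          case False
          then show ?thesis by (auto simp: value_at_P_poly_eq_0_iff[OF r])
        qed
        then have "(\<Sum>K\<in>- L - {J}. c K * value_at (vertex r (- J)) (P_poly r K)) = 0"
          by (intro sum.neutral) blast
        then show "c J * value_at (vertex r (- J)) (P_poly r J) +
            (\<Sum>K\<in>- L - {J}. c K * value_at (vertex r (- J)) (P_poly r K)) =
            c J * value_at (vertex r (- J)) (P_poly r J)" by simp
      qed (use psubset.prems in auto)
      moreover have "value_at (vertex r (- J)) (P_poly r J) \<noteq> 0"
        by (simp add: value_at_P_poly_eq_0_iff[OF r])
      ultimately show ?case using v[of "- J"] compl[of J] psubset.prems by auto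
    qed
    then have "(\<Sum>J\<in>-L. poly_in_t (c J) * P_poly r J) = 0"
      by (intro sum.neutral) auto
    with g show "f \<in> Idl\<^bsub>poly_ring\<^esub> ?G" by simp
  qed
qed

section \<open>The wedge product\<close>

text \<open>The grading automorphism, (-1)^k in degree k. Forms are inhomogeneous, so the sign in
  the contraction and Leibniz rules has to be an operator instead of a number.\<close>

definition signed :: "('v list \<Rightarrow> 'c::comm_ring_1) \<Rightarrow> 'v list \<Rightarrow> 'c" where
  "signed f = (\<lambda>ws. (-1) ^ length ws * f ws)"

lemma signed_signed [simp]: "signed (signed f) = f"
  by (simp add: signed_def fun_eq_iff flip: mult.assoc power_mult_distrib)

lemma signed_Cons: "(\<lambda>ws. signed f (v # ws)) = (\<lambda>ws. - signed (\<lambda>ws. f (v # ws)) ws)"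
  by (simp add: signed_def)

lemma signed_add: "signed (\<lambda>ws. f ws + g ws) = (\<lambda>ws. signed f ws + signed g ws)"
  by (simp add: signed_def distrib_left)

lemma wedge_Cons:
  "wedge f g (v # vs) = wedge (\<lambda>ws. f (v # ws)) g vs + wedge (signed f) (\<lambda>ws. g (v # ws)) vs"
  by (simp add: signed_def)

lemma wedge_scale_right: "wedge f (\<lambda>ws. c * g ws) vs = c * wedge f g vs"
proof (induction vs arbitrary: f g)
  case (Cons v vs)
  then show ?case
    using Cons[of "signed f" "\<lambda>ws. g (v # ws)"] Cons[of "\<lambda>ws. f (v # ws)" g]
    by (simp add: wedge_Cons algebra_simps del: wedge.simps)
qed (simp add: algebra_simps)

lemma wedge_minus_left: "wedge (\<lambda>ws. - f ws) g vs = - wedge f g vs"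
  using wedge_scale_left[of "-1" f g vs] by simp

lemma wedge_minus_right: "wedge f (\<lambda>ws. - g ws) vs = - wedge f g vs"
  using wedge_scale_right[of f "-1" g vs] by simp

lemma wedge_diff_left: "wedge (\<lambda>ws. f ws - f' ws) g vs = wedge f g vs - wedge f' g vs"
  using wedge_add_left[of f "\<lambda>ws. - f' ws" g vs] by (simp add: wedge_minus_left)

lemma wedge_diff_right: "wedge f (\<lambda>ws. g ws - g' ws) vs = wedge f g vs - wedge f g' vs"
  using wedge_add_right[of f g "\<lambda>ws. - g' ws" vs] by (simp add: wedge_minus_right)

lemma wedge_map: "wedge f g (map h vs) = wedge (\<lambda>ws. f (map h ws)) (\<lambda>ws. g (map h ws)) vs"
  by (induction vs arbitrary: f g) simp_all

text \<open>The recursion hands each factor only subsequences of \<open>vs\<close>. Hence identities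
  that hold for tangent vectors alone pass to wedge products.\<close>

lemma wedge_cong:
  assumes "\<And>ws. set ws \<subseteq> set vs \<Longrightarrow> f ws = f' ws" "\<And>ws. set ws \<subseteq> set vs \<Longrightarrow> g ws = g' ws"
  shows "wedge f g vs = wedge f' g' vs"
  using assms
proof (induction vs arbitrary: f f' g g')
  case (Cons v vs)
  have "wedge (\<lambda>ws. f (v # ws)) g vs = wedge (\<lambda>ws. f' (v # ws)) g' vs"
    by (intro Cons.IH Cons.prems) auto
  moreover have "wedge (signed f) (\<lambda>ws. g (v # ws)) vs = wedge (signed f') (\<lambda>ws. g' (v # ws)) vs"
    by (intro Cons.IH) (auto simp: signed_def intro!: arg_cong2[of _ _ _ _ "(*)"] Cons.prems)
  ultimately show ?case by (simp add: wedge_Cons del: wedge.simps)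
qed simp

section \<open>Multilinear and alternating functions on lists\<close>

definition multilinear :: "('v::real_vector list \<Rightarrow> complex) \<Rightarrow> bool" where
  "multilinear f \<longleftrightarrow> (\<forall>us vs. linear (\<lambda>v. f (us @ v # vs)))"

lemma multilinear_add:
  "multilinear f \<Longrightarrow> f (us @ (x + y) # vs) = f (us @ x # vs) + f (us @ y # vs)"
  unfolding multilinear_def by (rule linear_add[of "\<lambda>v. f (us @ v # vs)"]) blast

lemma multilinear_scale:
  "multilinear f \<Longrightarrow> f (us @ (c *\<^sub>R x) # vs) = of_real c * f (us @ x # vs)"
  unfolding multilinear_def scaleR_conv_of_real[symmetric]
  by (rule linear_scale[of "\<lambda>v. f (us @ v # vs)"]) blast

lemma multilinear_Cons:
  assumes "multilinear f"
  shows "multilinear (\<lambda>ws. f (v # ws))"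
proof -
  have "linear (\<lambda>x. f ((v # us) @ x # vs))" for us vs
    using assms unfolding multilinear_def by blast
  then show ?thesis by (simp add: multilinear_def)
qed

lemma multilinear_signed: "multilinear f \<Longrightarrow> multilinear (signed f)"
  unfolding multilinear_def signed_def linear_iff by (simp add: algebra_simps)

text \<open>Induction on the vectors before the varied slot: contracting the first of them leaves
  two products of multilinear factors, and when none is left the varied vector is itself contracted
  into either factor.\<close>

lemma multilinear_wedge:
  assumes "multilinear f" "multilinear g"
  shows "multilinear (wedge f g)"
proof -
  have "wedge f g (us @ (x + y) # vs) = wedge f g (us @ x # vs) + wedge f g (us @ y # vs) \<and>
      wedge f g (us @ (c *\<^sub>R x) # vs) = of_real c * wedge f g (us @ x # vs)" for us vs x y c
    using assms
  proof (induction us arbitrary: f g)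
    case Nil
    have "(\<lambda>ws. h ((x + y) # ws)) = (\<lambda>ws. h (x # ws) + h (y # ws))"
      "(\<lambda>ws. h ((c *\<^sub>R x) # ws)) = (\<lambda>ws. of_real c * h (x # ws))" if "multilinear h" for h
      using multilinear_add[OF that, of "[]" x y] multilinear_scale[OF that, of "[]" c x]
      by auto
    with Nil show ?case
      by (simp add: wedge_Cons wedge_add_left wedge_add_right wedge_scale_left wedge_scale_right
          algebra_simps del: wedge.simps)
  next
    case (Cons u us)
    then show ?case
      using Cons.IH[of "\<lambda>ws. f (u # ws)" g] Cons.IH[of "signed f" "\<lambda>ws. g (u # ws)"]
      by (simp add: wedge_Cons multilinear_Cons multilinear_signed algebra_simps del: wedge.simps)
  qed
  then show ?thesis
    by (auto simp: multilinear_def linear_iff scaleR_conv_of_real)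
qed

definition alternating :: "('v list \<Rightarrow> complex) \<Rightarrow> bool" where
  "alternating f \<longleftrightarrow> (\<forall>vs. \<not> distinct vs \<longrightarrow> f vs = 0)"

text \<open>Polarising the adjacent case gives a sign change under adjacent swaps, and such swaps
  bring any repeated pair together.\<close>

lemma alternatingI:
  assumes lin: "multilinear f" and adj: "\<And>us v vs. f (us @ v # v # vs) = 0"
  shows "alternating f"
proof -
  have swap: "f (us @ v # w # vs) = - f (us @ w # v # vs)" for us v w vs
  proof -
    have "f (us @ (v + w) # (v + w) # vs) =
        f (us @ v # v # vs) + f (us @ v # w # vs) + f (us @ w # v # vs) + f (us @ w # w # vs)"
      using multilinear_add[OF lin, of us v w "(v + w) # vs"]
        multilinear_add[OF lin, of "us @ [v]" v w vs] multilinear_add[OF lin, of "us @ [w]" v w vs]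
      by simp
    then show ?thesis by (simp add: adj eq_neg_iff_add_eq_0)
  qed
  have "f (us @ v # xs @ v # vs) = 0" for us v xs vs
  proof (induction xs arbitrary: us)
    case (Cons x xs)
    then show ?case using swap[of us v x "xs @ v # vs"] Cons[of "us @ [x]"] by simp
  qed (simp add: adj)
  then show ?thesis
    unfolding alternating_def using not_distinct_decomp by fastforce
qed

lemma alternating_Cons: "alternating f \<Longrightarrow> alternating (\<lambda>ws. f (v # ws))"
  unfolding alternating_def by simp

lemma alternating_signed: "alternating f \<Longrightarrow> alternating (signed f)"
  unfolding alternating_def signed_def by simp

text \<open>After contracting twice with the same v, the mixed terms apply to \<open>f\<close> the
  contraction and the grading sign, once in each order. These two operations anticommute, so the
  mixed terms cancel; the others vanish because the factors alternate.\<close>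

lemma alternating_wedge:
  assumes "multilinear f" "multilinear g" "alternating f" "alternating g"
  shows "alternating (wedge f g)"
proof (rule alternatingI)
  show "multilinear (wedge f g)" using assms by (intro multilinear_wedge)
  show "wedge f g (us @ v # v # vs) = 0" for us v vs
    using assms(3,4)
  proof (induction us arbitrary: f g)
    case Nil
    have "(\<lambda>ws. h (v # v # ws)) = (\<lambda>ws. 0)" if "alternating h" for h
      using that by (auto simp: alternating_def)
    with Nil show ?case
      by (simp add: wedge_Cons wedge_zero_left wedge_zero_right signed_Cons wedge_minus_left
          del: wedge.simps)
  next
    case (Cons u us)
    then show ?case
      by (simp add: wedge_Cons alternating_Cons alternating_signed del: wedge.simps)
  qed
qed


section \<open>Smooth functions\<close>

lemma frechet_derivative_eq:
  "(f has_derivative f') (at p) \<Longrightarrow> frechet_derivative f (at p) = f'"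
  using frechet_derivative_at by metis

lemma times_differentiable_Suc_imp: "times_differentiable (Suc n) f \<Longrightarrow> times_differentiable n f"
proof (induction n arbitrary: f)
  case 0
  then show ?case
    by (auto simp: continuous_on_eq_continuous_at differentiable_imp_continuous_within)
qed simp

lemma times_differentiable_SucI:
  assumes "\<And>p. (f has_derivative f' p) (at p)" "\<And>v. times_differentiable n (\<lambda>p. f' p v)"
  shows "times_differentiable (Suc n) f"
proof -
  have "(\<lambda>p. frechet_derivative f (at p) v) = (\<lambda>p. f' p v)" for v
    using frechet_derivative_eq[OF assms(1)] by simp
  then show ?thesis using assms by (auto simp: differentiable_def)
qed

lemma times_differentiable_const: "times_differentiable n (\<lambda>p. c)"
  by (induction n arbitrary: c) (simp_all add: frechet_derivative_const)

lemma times_differentiable_bounded_linear: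
  assumes "bounded_linear f"
  shows "times_differentiable n f"
proof (cases n)
  case 0
  then show ?thesis using assms by (simp add: linear_continuous_on)
next
  case (Suc m)
  have "(f has_derivative f) (at p)" for p
    using assms by (rule bounded_linear_imp_has_derivative)
  then show ?thesis
    unfolding Suc by (rule times_differentiable_SucI) (rule times_differentiable_const)
qed

lemma times_differentiable_add:
  assumes "times_differentiable n f" "times_differentiable n g"
  shows "times_differentiable n (\<lambda>p. f p + g p)"
  using assms
proof (induction n arbitrary: f g)
  case (Suc n)
  then have "((\<lambda>p. f p + g p) has_derivative
      (\<lambda>v. frechet_derivative f (at p) v + frechet_derivative g (at p) v)) (at p)" for p
    by (intro has_derivative_add) (simp_all add: frechet_derivative_works[symmetric])
  then show ?case
    by (rule times_differentiable_SucI) (use Suc in auto)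
qed (simp add: continuous_on_add)

lemma times_differentiable_mult:
  fixes f g :: "'a::real_normed_vector \<Rightarrow> 'b::real_normed_algebra"
  assumes "times_differentiable n f" "times_differentiable n g"
  shows "times_differentiable n (\<lambda>p. f p * g p)"
  using assms
proof (induction n arbitrary: f g)
  case (Suc n)
  then have "((\<lambda>p. f p * g p) has_derivative
      (\<lambda>v. f p * frechet_derivative g (at p) v + frechet_derivative f (at p) v * g p)) (at p)" for p
    by (intro has_derivative_mult) (simp_all add: frechet_derivative_works[symmetric])
  from this show ?case
  proof (rule times_differentiable_SucI)
    \<comment> \<open>The product rule keeps one factor undifferentiated, so the inductive
      hypothesis is also applied to \<open>f\<close> and \<open>g\<close> themselves, with the order
      lowered by one.\<close>
    have "times_differentiable n f" "times_differentiable n g"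
      using Suc.prems by (auto intro: times_differentiable_Suc_imp simp del: times_differentiable.simps)
    then show "times_differentiable n
        (\<lambda>p. f p * frechet_derivative g (at p) v + frechet_derivative f (at p) v * g p)" for v
      using Suc by (auto intro!: times_differentiable_add)
  qed
qed (simp add: continuous_on_mult)

lemma smooth_const: "smooth (\<lambda>p. c)"
  by (simp add: smooth_def times_differentiable_const)

lemma smooth_bounded_linear: "bounded_linear f \<Longrightarrow> smooth f"
  by (simp add: smooth_def times_differentiable_bounded_linear)

lemma smooth_add: "smooth f \<Longrightarrow> smooth g \<Longrightarrow> smooth (\<lambda>p. f p + g p)"
  by (simp add: smooth_def times_differentiable_add)

lemma smooth_mult:
  fixes f g :: "'a::real_normed_vector \<Rightarrow> 'b::real_normed_algebra"
  shows "smooth f \<Longrightarrow> smooth g \<Longrightarrow> smooth (\<lambda>p. f p * g p)"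
  by (simp add: smooth_def times_differentiable_mult)

lemma smooth_differentiable: "smooth f \<Longrightarrow> f differentiable (at p)"
  by (auto simp: smooth_def dest: spec[of _ "Suc 0"])

lemma smooth_signed:
  fixes w :: "'a::real_normed_vector \<Rightarrow> 'v list \<Rightarrow> complex"
  shows "\<forall>vs. smooth (\<lambda>p. w p vs) \<Longrightarrow> smooth (\<lambda>p. signed (w p) vs)"
  unfolding signed_def by (intro smooth_mult smooth_const) simp

lemma smooth_wedge:
  fixes w u :: "'a::real_normed_vector \<Rightarrow> 'v list \<Rightarrow> complex"
  assumes "\<forall>vs. smooth (\<lambda>p. w p vs)" "\<forall>vs. smooth (\<lambda>p. u p vs)"
  shows "smooth (\<lambda>p. wedge (w p) (u p) vs)"
  using assms
proof (induction vs arbitrary: w u)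
  case Nil
  then show ?case by (simp add: smooth_mult)
next
  case (Cons v vs)
  then show ?case
    unfolding wedge_Cons by (intro smooth_add Cons.IH allI smooth_signed) auto
qed


section \<open>The exterior derivative\<close>

text \<open>The formula of \<open>ext_deriv\<close> on bare families of functions, so that
  inductions on the argument list can pass to contractions \<open>w q (v # ws)\<close> without
  wrapping them as forms.\<close>

definition deriv_raw :: "('a::real_normed_vector \<Rightarrow> 'a list \<Rightarrow> complex) \<Rightarrow> 'a \<Rightarrow> 'a list \<Rightarrow> complex" where
  "deriv_raw w p vs = (\<Sum>i<length vs. (-1) ^ i *
     frechet_derivative (\<lambda>q. w q (take i vs @ drop (Suc i) vs)) (at p) (vs ! i))"

lemma form_at_ext_deriv: "form_at (ext_deriv \<omega>) = deriv_raw (form_at \<omega>)"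
  by (simp add: ext_deriv.rep_eq deriv_raw_def fun_eq_iff)

lemma deriv_raw_Nil: "deriv_raw w p [] = 0"
  by (simp add: deriv_raw_def)

text \<open>Cartan's formula \<open>\<iota>\<^sub>v d = L\<^sub>v - d \<iota>\<^sub>v\<close> for a constant vector field \<open>v\<close>.\<close>

lemma deriv_raw_Cons:
  "deriv_raw w p (v # vs) =
   frechet_derivative (\<lambda>q. w q vs) (at p) v - deriv_raw (\<lambda>q ws. w q (v # ws)) p vs"
  unfolding deriv_raw_def length_Cons sum.lessThan_Suc_shift by (simp add: sum_negf)

lemma deriv_raw_add:
  assumes "\<forall>vs. (\<lambda>q. w q vs) differentiable (at p)" "\<forall>vs. (\<lambda>q. u q vs) differentiable (at p)"
  shows "deriv_raw (\<lambda>q vs. w q vs + u q vs) p vs = deriv_raw w p vs + deriv_raw u p vs"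
proof -
  have "frechet_derivative (\<lambda>q. w q ws + u q ws) (at p) =
      (\<lambda>v. frechet_derivative (\<lambda>q. w q ws) (at p) v + frechet_derivative (\<lambda>q. u q ws) (at p) v)" for ws
    using assms by (intro frechet_derivative_eq has_derivative_add) (simp_all add: frechet_derivative_works[symmetric])
  then show ?thesis
    by (simp add: deriv_raw_def distrib_left sum.distrib)
qed

text \<open>The exterior derivative raises the degree by one and so anticommutes with the grading
  sign: each summand evaluates \<open>w\<close> on a list shorter by one.\<close>

lemma deriv_raw_signed:
  assumes "\<forall>vs. (\<lambda>q. w q vs) differentiable (at p)"
  shows "deriv_raw (\<lambda>q. signed (w q)) p = (\<lambda>vs. - signed (deriv_raw w p) vs)"
proof
  fix vs
  have "(-1) ^ i * frechet_derivative (\<lambda>q. signed (w q) (take i vs @ drop (Suc i) vs)) (at p) (vs ! i) =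
      - ((-1) ^ length vs * ((-1) ^ i *
        frechet_derivative (\<lambda>q. w q (take i vs @ drop (Suc i) vs)) (at p) (vs ! i)))"
    if "i < length vs" for i
  proof -
    let ?ws = "take i vs @ drop (Suc i) vs"
    have "length vs = Suc (length ?ws)" using that by simp
    then have "(-1) ^ length ?ws = - ((-1) ^ length vs :: complex)" by (simp only: power_Suc) simp
    moreover have "((\<lambda>q. (-1) ^ length ?ws * w q ?ws) has_derivative
        (\<lambda>v. (-1) ^ length ?ws * frechet_derivative (\<lambda>q. w q ?ws) (at p) v)) (at p)"
      using assms by (intro has_derivative_mult_right) (simp add: frechet_derivative_works[symmetric])
    ultimately show ?thesis
      unfolding signed_def by (subst frechet_derivative_eq) auto
  qed
  then show "deriv_raw (\<lambda>q. signed (w q)) p vs = - signed (deriv_raw w p) vs"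
    by (simp add: deriv_raw_def signed_def sum_distrib_left sum_negf[symmetric])
qed

text \<open>The product rule in the base point for fixed arguments: the wedge is bilinear in the
  values of its factors.\<close>

lemma has_derivative_wedge:
  fixes w u :: "'a::real_normed_vector \<Rightarrow> 'v list \<Rightarrow> complex"
  assumes "\<And>vs. ((\<lambda>q. w q vs) has_derivative (\<lambda>h. w' h vs)) (at p)"
    and "\<And>vs. ((\<lambda>q. u q vs) has_derivative (\<lambda>h. u' h vs)) (at p)"
  shows "((\<lambda>q. wedge (w q) (u q) vs) has_derivative
    (\<lambda>h. wedge (w' h) (u p) vs + wedge (w p) (u' h) vs)) (at p)"
  using assms
proof (induction vs arbitrary: w u w' u')
  case Nil
  then show ?case
    using has_derivative_mult[OF Nil(1)[of "[]"] Nil(2)[of "[]"]] by (simp add: add.commute)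
next
  case (Cons v vs)
  have "((\<lambda>q. signed (w q) ws) has_derivative (\<lambda>h. signed (w' h) ws)) (at p)" for ws
    unfolding signed_def by (intro has_derivative_mult_right Cons.prems)
  then have "((\<lambda>q. wedge (w q) (u q) (v # vs)) has_derivative
      (\<lambda>h. (wedge (\<lambda>ws. w' h (v # ws)) (u p) vs + wedge (\<lambda>ws. w p (v # ws)) (u' h) vs) +
           (wedge (signed (w' h)) (\<lambda>ws. u p (v # ws)) vs + wedge (signed (w p)) (\<lambda>ws. u' h (v # ws)) vs))) (at p)"
    unfolding wedge_Cons by (intro has_derivative_add Cons.IH Cons.prems)
  then show ?case
    by (simp add: wedge_Cons add_ac del: wedge.simps)
qed

text \<open>The antiderivation property. Cartan's formula splits off the derivative along v, where
  the ordinary product rule applies, from the exterior derivative of the contraction, a sum of two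
  wedge products covered by the inductive hypothesis. Cartan's formula for each factor then
  reassembles the terms.\<close>

lemma deriv_raw_wedge:
  fixes w u :: "'a::real_normed_vector \<Rightarrow> 'a list \<Rightarrow> complex"
  assumes "\<forall>vs. (\<lambda>q. w q vs) differentiable (at p)" "\<forall>vs. (\<lambda>q. u q vs) differentiable (at p)"
  shows "deriv_raw (\<lambda>q. wedge (w q) (u q)) p vs =
    wedge (deriv_raw w p) (u p) vs + wedge (signed (w p)) (deriv_raw u p) vs"
  using assms
proof (induction vs arbitrary: w u)
  case Nil
  show ?case by (simp add: deriv_raw_Nil)
next
  case (Cons v vs)
  let ?D = "\<lambda>w ws. frechet_derivative (\<lambda>q. w q ws) (at p) v"
  let ?i = "\<lambda>w q ws. w q (v # ws)"
  have hd: "((\<lambda>q. wedge (w q) (u q) ws) has_derivative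
      (\<lambda>h. wedge (\<lambda>vs. frechet_derivative (\<lambda>q. w q vs) (at p) h) (u p) ws +
           wedge (w p) (\<lambda>vs. frechet_derivative (\<lambda>q. u q vs) (at p) h) ws)) (at p)"
    if "\<forall>vs. (\<lambda>q. w q vs) differentiable (at p)" "\<forall>vs. (\<lambda>q. u q vs) differentiable (at p)"
    for w u :: "'a \<Rightarrow> 'a list \<Rightarrow> complex" and ws
    by (rule has_derivative_wedge[where w = w and u = u and w' = "\<lambda>h vs. frechet_derivative (\<lambda>q. w q vs) (at p) h"
          and u' = "\<lambda>h vs. frechet_derivative (\<lambda>q. u q vs) (at p) h"])
      (use that in \<open>simp_all add: frechet_derivative_works[symmetric]\<close>)
  have sg: "\<forall>vs. (\<lambda>q. signed (w q) vs) differentiable (at p)"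
    using Cons.prems(1) unfolding signed_def by (intro allI differentiable_mult) auto
  have "deriv_raw (\<lambda>q ws. wedge (w q) (u q) (v # ws)) p vs =
      deriv_raw (\<lambda>q. wedge (?i w q) (u q)) p vs + deriv_raw (\<lambda>q. wedge (signed (w q)) (?i u q)) p vs"
    unfolding wedge_Cons
    by (rule deriv_raw_add; intro allI differentiableI[OF hd] sg) (use Cons.prems in auto)
  also have "deriv_raw (\<lambda>q. wedge (?i w q) (u q)) p vs =
      wedge (deriv_raw (?i w) p) (u p) vs + wedge (signed (?i w p)) (deriv_raw u p) vs"
    using Cons.prems by (intro Cons.IH) auto
  \<comment> \<open>The left factor already carries a grading sign, which the sign of the Leibniz
    rule cancels.\<close>
  also have "deriv_raw (\<lambda>q. wedge (signed (w q)) (?i u q)) p vs =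
      wedge (deriv_raw (\<lambda>q. signed (w q)) p) (?i u p) vs + wedge (w p) (deriv_raw (?i u) p) vs"
    using Cons.prems sg by (subst Cons.IH) auto
  also have "deriv_raw (\<lambda>q. signed (w q)) p = (\<lambda>vs. - signed (deriv_raw w p) vs)"
    using Cons.prems by (intro deriv_raw_signed) auto
  finally have 1: "deriv_raw (\<lambda>q ws. wedge (w q) (u q) (v # ws)) p vs =
      wedge (deriv_raw (?i w) p) (u p) vs + wedge (signed (?i w p)) (deriv_raw u p) vs +
      (- wedge (signed (deriv_raw w p)) (?i u p) vs + wedge (w p) (deriv_raw (?i u) p) vs)"
    by (simp add: wedge_minus_left)
  have "deriv_raw (\<lambda>q. wedge (w q) (u q)) p (v # vs) =
      wedge (?D w) (u p) vs + wedge (w p) (?D u) vs - deriv_raw (\<lambda>q ws. wedge (w q) (u q) (v # ws)) p vs"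
    by (simp add: deriv_raw_Cons frechet_derivative_eq[OF hd[OF Cons.prems]] del: wedge.simps)
  also have "\<dots> = wedge (deriv_raw w p) (u p) (v # vs) + wedge (signed (w p)) (deriv_raw u p) (v # vs)"
    unfolding 1 unfolding wedge_Cons deriv_raw_Cons signed_Cons
    by (simp add: wedge_diff_left wedge_diff_right wedge_minus_left algebra_simps)
  finally show ?case .
qed

section \<open>Closure properties of forms\<close>

lemma smooth_forms_iff:
  "\<omega> \<in> smooth_forms \<longleftrightarrow> (\<forall>p. multilinear (form_at \<omega> p)) \<and> (\<forall>p. alternating (form_at \<omega> p)) \<and>
     (\<forall>vs. smooth (\<lambda>p. form_at \<omega> p vs))"
  by (auto simp: smooth_forms_def multilinear_def alternating_def)

lemma smooth_forms_0: "0 \<in> smooth_forms"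
  by (simp add: smooth_forms_iff multilinear_def alternating_def zero_form.rep_eq smooth_const linear_iff)

lemma smooth_forms_add: "\<omega> \<in> smooth_forms \<Longrightarrow> \<eta> \<in> smooth_forms \<Longrightarrow> \<omega> + \<eta> \<in> smooth_forms"
  by (auto simp: smooth_forms_iff multilinear_def alternating_def plus_form.rep_eq
      intro: smooth_add linear_compose_add)

lemma smooth_forms_mult:
  "\<omega> \<in> smooth_forms \<Longrightarrow> \<eta> \<in> smooth_forms \<Longrightarrow> \<omega> * \<eta> \<in> smooth_forms"
  by (auto simp: smooth_forms_iff times_form.rep_eq
      intro: multilinear_wedge alternating_wedge smooth_wedge)

lemma smooth_forms_differentiable:
  "\<omega> \<in> smooth_forms \<Longrightarrow> (\<lambda>p. form_at \<omega> p vs) differentiable (at p)"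
  by (simp add: smooth_forms_iff smooth_differentiable)

text \<open>Being fixed by the grading sign means vanishing on lists of odd length. For an even left
  factor, \<open>ext_deriv\<close> and \<open>contract\<close> obey the Leibniz rule without
  signs.\<close>

definition even_forms :: "'a form set" where
  "even_forms = {\<omega>. \<forall>p. signed (form_at \<omega> p) = form_at \<omega> p}"

lemma ext_deriv_add:
  "\<omega> \<in> smooth_forms \<Longrightarrow> \<eta> \<in> smooth_forms \<Longrightarrow> ext_deriv (\<omega> + \<eta>) = ext_deriv \<omega> + ext_deriv \<eta>"
  by (intro form_at_inject[THEN iffD1] ext)
    (simp add: form_at_ext_deriv plus_form.rep_eq deriv_raw_add[where w = "form_at \<omega>" and u = "form_at \<eta>", symmetric]
      smooth_forms_differentiable)

lemma ext_deriv_mult: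
  assumes "\<omega> \<in> smooth_forms" "\<omega> \<in> even_forms" "\<eta> \<in> smooth_forms"
  shows "ext_deriv (\<omega> * \<eta>) = ext_deriv \<omega> * \<eta> + \<omega> * ext_deriv \<eta>"
proof (intro form_at_inject[THEN iffD1] ext)
  fix p vs
  show "form_at (ext_deriv (\<omega> * \<eta>)) p vs = form_at (ext_deriv \<omega> * \<eta> + \<omega> * ext_deriv \<eta>) p vs"
    using deriv_raw_wedge[of "form_at \<omega>" p "form_at \<eta>" vs] assms
    by (simp add: form_at_ext_deriv plus_form.rep_eq times_form.rep_eq even_forms_def
        smooth_forms_differentiable)
qed

lemma ext_deriv_0 [simp]: "ext_deriv 0 = 0"
  by (intro form_at_inject[THEN iffD1] ext)
    (simp add: form_at_ext_deriv deriv_raw_def zero_form.rep_eq)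

lemma contract_0 [simp]: "contract X 0 = 0"
  by (intro form_at_inject[THEN iffD1] ext) (simp add: contract.rep_eq zero_form.rep_eq)

lemma contract_add: "contract X (\<omega> + \<eta>) = contract X \<omega> + contract X \<eta>"
  by (intro form_at_inject[THEN iffD1] ext) (simp add: contract.rep_eq plus_form.rep_eq)

lemma contract_mult:
  assumes "\<omega> \<in> even_forms"
  shows "contract X (\<omega> * \<eta>) = contract X \<omega> * \<eta> + \<omega> * contract X \<eta>"
proof (intro form_at_inject[THEN iffD1] ext)
  fix p vs
  show "form_at (contract X (\<omega> * \<eta>)) p vs = form_at (contract X \<omega> * \<eta> + \<omega> * contract X \<eta>) p vs"
    using assms
    by (simp add: contract.rep_eq plus_form.rep_eq times_form.rep_eq even_forms_def wedge_Cons
        del: wedge.simps)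
qed

text \<open>The condition in \<open>vanishes_on\<close> bears on each power of t separately; for one
  coefficient it describes the kernel of restriction to M, a two-sided ideal.\<close>

definition null_forms :: "('n::finite \<Rightarrow> real) \<Rightarrow> (real^3^'n) form set" where
  "null_forms r = {\<omega>. \<forall>p\<in>spheres r. \<forall>vs. set vs \<subseteq> tangent p \<longrightarrow> form_at \<omega> p vs = 0}"

definition invariant_forms :: "('n::finite \<Rightarrow> real) \<Rightarrow> (real^3^'n) form set" where
  "invariant_forms r = {\<omega>. \<forall>\<theta>. \<forall>p\<in>spheres r. \<forall>vs. set vs \<subseteq> tangent p \<longrightarrow>
     form_at \<omega> (rotate_all \<theta> p) (map (rotate_all \<theta>) vs) = form_at \<omega> p vs}"

lemma vanishes_on_iff: "vanishes_on r \<alpha> \<longleftrightarrow> (\<forall>k. Poly_Mapping.lookup \<alpha> k \<in> null_forms r)"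
  by (auto simp: vanishes_on_def null_forms_def)

lemma cartan_forms_iff:
  "\<alpha> \<in> cartan_forms r \<longleftrightarrow> (\<forall>k. Poly_Mapping.lookup \<alpha> k \<in> smooth_forms \<inter> invariant_forms r)"
  by (auto simp: cartan_forms_def invariant_forms_def)

lemma null_forms_0: "0 \<in> null_forms r"
  by (simp add: null_forms_def zero_form.rep_eq)

lemma null_forms_add: "\<omega> \<in> null_forms r \<Longrightarrow> \<eta> \<in> null_forms r \<Longrightarrow> \<omega> + \<eta> \<in> null_forms r"
  by (simp add: null_forms_def plus_form.rep_eq)

lemma null_forms_mult_left: "\<omega> \<in> null_forms r \<Longrightarrow> \<omega> * \<eta> \<in> null_forms r"
  unfolding null_forms_def
proof (intro CollectI ballI allI impI)
  fix p vs assume *: "\<omega> \<in> {\<omega>. \<forall>p\<in>spheres r. \<forall>vs. set vs \<subseteq> tangent p \<longrightarrow> form_at \<omega> p vs = 0}"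
    "p \<in> spheres r" "set vs \<subseteq> tangent p"
  have "wedge (form_at \<omega> p) (form_at \<eta> p) vs = wedge (\<lambda>_. 0) (form_at \<eta> p) vs"
    by (rule wedge_cong) (use * in auto)
  then show "form_at (\<omega> * \<eta>) p vs = 0" by (simp add: times_form.rep_eq wedge_zero_left)
qed

lemma null_forms_mult_right: "\<eta> \<in> null_forms r \<Longrightarrow> \<omega> * \<eta> \<in> null_forms r"
  unfolding null_forms_def
proof (intro CollectI ballI allI impI)
  fix p vs assume *: "\<eta> \<in> {\<omega>. \<forall>p\<in>spheres r. \<forall>vs. set vs \<subseteq> tangent p \<longrightarrow> form_at \<omega> p vs = 0}"
    "p \<in> spheres r" "set vs \<subseteq> tangent p"
  have "wedge (form_at \<omega> p) (form_at \<eta> p) vs = wedge (form_at \<omega> p) (\<lambda>_. 0) vs"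
    by (rule wedge_cong) (use * in auto)
  then show "form_at (\<omega> * \<eta>) p vs = 0" by (simp add: times_form.rep_eq wedge_zero_right)
qed

lemma invariant_forms_0: "0 \<in> invariant_forms r"
  by (simp add: invariant_forms_def zero_form.rep_eq)

lemma invariant_forms_add:
  "\<omega> \<in> invariant_forms r \<Longrightarrow> \<eta> \<in> invariant_forms r \<Longrightarrow> \<omega> + \<eta> \<in> invariant_forms r"
  by (simp add: invariant_forms_def plus_form.rep_eq)

text \<open>Pullback by a rotation distributes over the wedge by \<open>wedge_map\<close>;
  invariance is known on tangent vectors, which is what \<open>wedge_cong\<close> asks for.\<close>

lemma invariant_forms_mult:
  assumes "\<omega> \<in> invariant_forms r" "\<eta> \<in> invariant_forms r"
  shows "\<omega> * \<eta> \<in> invariant_forms r"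
proof -
  have "wedge (form_at \<omega> (rotate_all \<theta> p)) (form_at \<eta> (rotate_all \<theta> p)) (map (rotate_all \<theta>) vs) =
      wedge (form_at \<omega> p) (form_at \<eta> p) vs" if "p \<in> spheres r" "set vs \<subseteq> tangent p" for \<theta> p vs
    unfolding wedge_map by (rule wedge_cong) (use assms that in \<open>auto simp: invariant_forms_def\<close>)
  then show ?thesis by (simp add: invariant_forms_def times_form.rep_eq)
qed

definition coeffs_in :: "'c::zero set \<Rightarrow> ('k \<Rightarrow>\<^sub>0 'c) set" where
  "coeffs_in S = {\<alpha>. \<forall>k. Poly_Mapping.lookup \<alpha> k \<in> S}"

lemma coeffs_in_0: "0 \<in> S \<Longrightarrow> 0 \<in> coeffs_in S"
  by (simp add: coeffs_in_def)

lemma coeffs_in_single: "0 \<in> S \<Longrightarrow> c \<in> S \<Longrightarrow> Poly_Mapping.single k c \<in> coeffs_in S"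
  by (simp add: coeffs_in_def lookup_single when_def)

lemma coeffs_in_add:
  assumes "\<And>a b. a \<in> S \<Longrightarrow> b \<in> S \<Longrightarrow> a + b \<in> S" "\<alpha> \<in> coeffs_in S" "\<beta> \<in> coeffs_in S"
  shows "\<alpha> + \<beta> \<in> coeffs_in S"
  using assms by (simp add: coeffs_in_def lookup_add)

text \<open>Additivity of the differential is available for smooth coefficients, so an induction
  over sums has to remember that the pieces keep their coefficients in \<open>S\<close>.\<close>

lemma coeffs_in_induct [consumes 2, case_names zero add single]:
  assumes "\<alpha> \<in> coeffs_in S" "0 \<in> S" "P 0"
    and "\<And>\<beta> \<gamma>. \<lbrakk>\<beta> \<in> coeffs_in S; \<gamma> \<in> coeffs_in S; P \<beta>; P \<gamma>\<rbrakk> \<Longrightarrow> P (\<beta> + \<gamma>)"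
    and "\<And>k c. c \<in> S \<Longrightarrow> P (Poly_Mapping.single k c)"
  shows "P (\<alpha> :: 'k \<Rightarrow>\<^sub>0 'c::comm_monoid_add)"
  by (rule poly_mapping_additive_induct[of S]) (use assms in \<open>auto simp: coeffs_in_def\<close>)

text \<open>Three separate sets, so that one argument yields the closure of Cartan forms under
  products and, with \<open>UNIV\<close> for one factor, the ideal property of forms vanishing on
  M.\<close>

lemma coeffs_in_mult:
  fixes \<alpha> \<beta> :: "nat \<Rightarrow>\<^sub>0 'c::semiring_0"
  assumes "0 \<in> A" "0 \<in> B" "0 \<in> C"
    and mult: "\<And>a b. a \<in> A \<Longrightarrow> b \<in> B \<Longrightarrow> a * b \<in> C"
    and add: "\<And>a b. a \<in> C \<Longrightarrow> b \<in> C \<Longrightarrow> a + b \<in> C"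
    and "\<alpha> \<in> coeffs_in A" "\<beta> \<in> coeffs_in B"
  shows "\<alpha> * \<beta> \<in> coeffs_in C"
  using \<open>\<alpha> \<in> coeffs_in A\<close> \<open>0 \<in> A\<close>
proof (induction \<alpha> rule: coeffs_in_induct)
  case (single k c)
  show ?case
    using \<open>\<beta> \<in> coeffs_in B\<close> \<open>0 \<in> B\<close>
  proof (induction \<beta> rule: coeffs_in_induct)
    case (single l d)
    then show ?case
      using \<open>c \<in> A\<close> assms(3) by (simp add: mult_single mult coeffs_in_single)
  qed (use assms(3) add in \<open>auto simp: distrib_left coeffs_in_0 intro: coeffs_in_add\<close>)
qed (use assms(3) add in \<open>auto simp: distrib_right coeffs_in_0 intro: coeffs_in_add\<close>)

lemma cartan_forms_eq: "cartan_forms r = coeffs_in (smooth_forms \<inter> invariant_forms r)"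
  by (auto simp: cartan_forms_iff coeffs_in_def)

lemma vanishes_on_eq: "vanishes_on r \<alpha> \<longleftrightarrow> \<alpha> \<in> coeffs_in (null_forms r)"
  by (simp add: vanishes_on_iff coeffs_in_def)

lemma cartan_forms_0: "0 \<in> cartan_forms r"
  by (simp add: cartan_forms_eq coeffs_in_0 smooth_forms_0 invariant_forms_0)

lemma cartan_forms_add: "\<alpha> \<in> cartan_forms r \<Longrightarrow> \<beta> \<in> cartan_forms r \<Longrightarrow> \<alpha> + \<beta> \<in> cartan_forms r"
  unfolding cartan_forms_eq
  by (rule coeffs_in_add) (auto intro: smooth_forms_add invariant_forms_add)

lemma cartan_forms_mult: "\<alpha> \<in> cartan_forms r \<Longrightarrow> \<beta> \<in> cartan_forms r \<Longrightarrow> \<alpha> * \<beta> \<in> cartan_forms r"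
  unfolding cartan_forms_eq
  by (rule coeffs_in_mult[where A = "smooth_forms \<inter> invariant_forms r" and B = "smooth_forms \<inter> invariant_forms r"])
    (auto intro: smooth_forms_add invariant_forms_add smooth_forms_mult invariant_forms_mult
      smooth_forms_0 invariant_forms_0)

lemma vanishes_on_add: "vanishes_on r \<alpha> \<Longrightarrow> vanishes_on r \<beta> \<Longrightarrow> vanishes_on r (\<alpha> + \<beta>)"
  unfolding vanishes_on_eq by (rule coeffs_in_add) (rule null_forms_add)

lemma vanishes_on_mult_left: "vanishes_on r \<alpha> \<Longrightarrow> vanishes_on r (\<alpha> * \<beta>)"
  unfolding vanishes_on_eq
  by (rule coeffs_in_mult[where A = "null_forms r" and B = UNIV])
    (auto intro: null_forms_0 null_forms_add null_forms_mult_left simp: coeffs_in_def)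

lemma vanishes_on_mult_right: "vanishes_on r \<beta> \<Longrightarrow> vanishes_on r (\<alpha> * \<beta>)"
  unfolding vanishes_on_eq
  by (rule coeffs_in_mult[where B = "null_forms r" and A = UNIV])
    (auto intro: null_forms_0 null_forms_add null_forms_mult_right simp: coeffs_in_def)


section \<open>The Cartan differential\<close>

lemma lookup_map_0:
  "f 0 = 0 \<Longrightarrow> Poly_Mapping.lookup (Poly_Mapping.map f \<alpha>) k = f (Poly_Mapping.lookup \<alpha> k)"
  by transfer (auto simp: when_def)

lemma map_additive:
  assumes "f 0 = 0" "\<And>k. f (Poly_Mapping.lookup \<alpha> k + Poly_Mapping.lookup \<beta> k) =
    f (Poly_Mapping.lookup \<alpha> k) + f (Poly_Mapping.lookup \<beta> k)"
  shows "Poly_Mapping.map f (\<alpha> + \<beta>) = Poly_Mapping.map f \<alpha> + Poly_Mapping.map f \<beta>"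
  by (rule poly_mapping_eqI) (simp add: lookup_map_0 lookup_add assms)

lemma map_0: "f 0 = 0 \<Longrightarrow> Poly_Mapping.map f 0 = 0"
  by (rule poly_mapping_eqI) (simp add: lookup_map_0)

lemma cartan_d_0 [simp]: "cartan_d 0 = 0"
  by (simp add: cartan_d_def map_0)

lemma cartan_d_add:
  assumes "\<alpha> \<in> coeffs_in smooth_forms" "\<beta> \<in> coeffs_in smooth_forms"
  shows "cartan_d (\<alpha> + \<beta>) = cartan_d \<alpha> + cartan_d \<beta>"
proof -
  have "Poly_Mapping.map ext_deriv (\<alpha> + \<beta>) = Poly_Mapping.map ext_deriv \<alpha> + Poly_Mapping.map ext_deriv \<beta>"
    using assms by (intro map_additive) (auto simp: coeffs_in_def ext_deriv_add)
  moreover have "Poly_Mapping.map (contract X) (\<alpha> + \<beta>) =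
      Poly_Mapping.map (contract X) \<alpha> + Poly_Mapping.map (contract X) \<beta>" for X
    by (intro map_additive) (auto simp: contract_add)
  ultimately show ?thesis
    by (simp add: cartan_d_def algebra_simps)
qed

lemma cartan_d_single:
  "cartan_d (Poly_Mapping.single k \<omega>) =
   Poly_Mapping.single k (ext_deriv \<omega>) - Poly_Mapping.single (Suc k) (contract fundamental_field \<omega>)"
  by (simp add: cartan_d_def mult_single)

text \<open>Both sides are biadditive on smooth coefficients, which leaves single powers of t. There
  exterior derivative and contraction each obey the sign-free Leibniz rule, and t is
  central.\<close>

lemma cartan_d_mult:
  assumes "\<alpha> \<in> coeffs_in (smooth_forms \<inter> even_forms)" "\<beta> \<in> coeffs_in smooth_forms"
  shows "cartan_d (\<alpha> * \<beta>) = cartan_d \<alpha> * \<beta> + \<alpha> * cartan_d \<beta>"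
proof -
  have 0: "0 \<in> smooth_forms \<inter> even_forms"
    using smooth_forms_0 by (simp add: even_forms_def zero_form.rep_eq signed_def)
  have mult: "\<alpha> * \<beta> \<in> coeffs_in smooth_forms"
    if "\<alpha> \<in> coeffs_in (smooth_forms \<inter> even_forms)" "\<beta> \<in> coeffs_in smooth_forms" for \<alpha> \<beta> :: "'a tform"
    by (rule coeffs_in_mult[OF _ _ _ _ _ that])
      (use 0 smooth_forms_0 in \<open>auto intro: smooth_forms_add smooth_forms_mult\<close>)
  show ?thesis
    using assms(1) 0
  proof (induction \<alpha> rule: coeffs_in_induct)
    case (add \<gamma> \<delta>)
    have "\<gamma> \<in> coeffs_in smooth_forms" "\<delta> \<in> coeffs_in smooth_forms"
      using add by (auto simp: coeffs_in_def)
    with add mult[OF add(1) assms(2)] mult[OF add(2) assms(2)] show ?case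
      by (simp add: cartan_d_add distrib_left distrib_right algebra_simps)
  next
    case (single k \<omega>)
    then have \<omega>: "Poly_Mapping.single k \<omega> \<in> coeffs_in (smooth_forms \<inter> even_forms)"
      using 0 by (intro coeffs_in_single)
    show ?case
      using assms(2) smooth_forms_0
    proof (induction \<beta> rule: coeffs_in_induct)
      case (add \<gamma> \<delta>)
      with mult[OF \<omega> add(1)] mult[OF \<omega> add(2)] show ?case
        by (simp add: cartan_d_add distrib_left distrib_right algebra_simps)
    next
      case (single l \<eta>)
      with \<open>\<omega> \<in> smooth_forms \<inter> even_forms\<close> show ?case
        by (simp add: mult_single cartan_d_single ext_deriv_mult contract_mult single_add algebra_simps)
    qed simp
  qed simp
qed

section \<open>Sums and even products of cocycles\<close>

lemma cocycles_0: "0 \<in> cocycles r"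
  by (simp add: cocycles_def cartan_forms_0 vanishes_on_eq coeffs_in_0 null_forms_0)

lemma cartan_forms_smooth: "\<alpha> \<in> cartan_forms r \<Longrightarrow> \<alpha> \<in> coeffs_in smooth_forms"
  by (auto simp: cartan_forms_eq coeffs_in_def)

lemma cocycles_add: "\<alpha> \<in> cocycles r \<Longrightarrow> \<beta> \<in> cocycles r \<Longrightarrow> \<alpha> + \<beta> \<in> cocycles r"
  by (auto simp: cocycles_def cartan_d_add cartan_forms_smooth intro: cartan_forms_add vanishes_on_add)

lemma cocycles_mult:
  assumes "\<alpha> \<in> cocycles r" "\<alpha> \<in> coeffs_in even_forms" "\<beta> \<in> cocycles r"
  shows "\<alpha> * \<beta> \<in> cocycles r"
proof -
  have "cartan_d (\<alpha> * \<beta>) = cartan_d \<alpha> * \<beta> + \<alpha> * cartan_d \<beta>"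
    using assms by (intro cartan_d_mult) (auto simp: cocycles_def coeffs_in_def cartan_forms_eq)
  with assms show ?thesis
    by (auto simp: cocycles_def intro: cartan_forms_mult vanishes_on_add vanishes_on_mult_left vanishes_on_mult_right)
qed

text \<open>The trailing cocycle lets each step multiply from the left by the even cocycle itself,
  as \<open>cocycles_mult\<close> requires.\<close>

lemma cocycles_power_mult:
  assumes "\<alpha> \<in> cocycles r" "\<alpha> \<in> coeffs_in even_forms" "\<beta> \<in> cocycles r"
  shows "\<alpha> ^ k * \<beta> \<in> cocycles r"
  by (induction k) (simp_all add: assms cocycles_mult mult.assoc)

lemma even_forms_0: "0 \<in> even_forms"
  by (simp add: even_forms_def zero_form.rep_eq signed_def)

lemma even_formsI:
  assumes "\<And>p vs. odd (length vs) \<Longrightarrow> form_at \<omega> p vs = 0"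
  shows "\<omega> \<in> even_forms"
  using assms by (auto simp: even_forms_def signed_def fun_eq_iff minus_one_power_iff)

lemma even_forms_add: "\<omega> \<in> even_forms \<Longrightarrow> \<eta> \<in> even_forms \<Longrightarrow> \<omega> + \<eta> \<in> even_forms"
  by (simp add: even_forms_def plus_form.rep_eq signed_add)

section \<open>The circle action\<close>

lemma rotate_all_nth [simp]: "rotate_all \<theta> p $ j = rotz \<theta> (p $ j)"
  by (simp add: rotate_all_def)

lemma fundamental_field_nth: "fundamental_field p $ j = vector [- (p $ j $ 2), p $ j $ 1, 0]"
proof -
  \<comment> \<open>The orbit is cos A + sin B + C with constant vectors, so its velocity at angle 0
    is B.\<close>
  let ?A = "\<chi> j. (vector [p $ j $ 1, p $ j $ 2, 0] :: real^3)"
  let ?B = "\<chi> j. (vector [- (p $ j $ 2), p $ j $ 1, 0] :: real^3)"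
  let ?C = "\<chi> j. (vector [0, 0, p $ j $ 3] :: real^3)"
  have "rotate_all \<theta> p = cos \<theta> *\<^sub>R ?A + sin \<theta> *\<^sub>R ?B + ?C" for \<theta>
    by (simp add: vec_eq_iff rotz_def forall_3 vector_3 algebra_simps)
  moreover have "((\<lambda>\<theta>. cos \<theta> *\<^sub>R ?A + sin \<theta> *\<^sub>R ?B + ?C) has_vector_derivative ?B) (at 0)"
    by (rule has_vector_derivative_eq_rhs, (rule derivative_intros)+) simp
  ultimately show ?thesis
    by (simp add: fundamental_field_def vector_derivative_at)
qed

lemma fundamental_field_fixed:
  "p \<in> fixed_points r \<Longrightarrow> fundamental_field p = 0"
  by (simp add: fundamental_field_def fixed_points_def)

lemma triple_product_rotz:
  "rotz \<theta> u \<bullet> cross3 (rotz \<theta> v) (rotz \<theta> w) = u \<bullet> cross3 v w"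
proof -
  \<comment> \<open>With \<open>cos\<close> and \<open>sin\<close> replaced by free reals this is a
    polynomial identity whose factor c^2 + s^2 is the determinant of \<open>R c s\<close>.\<close>
  define R where "R c s u = (vector [c * u $ 1 - s * u $ 2, s * u $ 1 + c * u $ 2, u $ 3] :: real^3)"
    for c s and u :: "real^3"
  have "R c s u \<bullet> cross3 (R c s v) (R c s w) = (c\<^sup>2 + s\<^sup>2) * (u \<bullet> cross3 v w)" for c s
    by (simp add: R_def cross3_def inner_vec_def sum_3 vector_3 power2_eq_square algebra_simps)
  from this[of "cos \<theta>" "sin \<theta>"] show ?thesis by (simp add: R_def rotz_def)
qed

section \<open>The poles\<close>

lemma pole_nth: "pole r J $ j = (if j \<in> J then r j else - r j) *\<^sub>R axis 3 1"
  by (simp add: pole_def)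

lemma height_pole: "height j (pole r J) = (if j \<in> J then r j else - r j)"
  by (simp add: height_def pole_nth)

lemma moment_pole: "moment (pole r J) = (\<Sum>j\<in>UNIV. if j \<in> J then r j else - r j)"
  by (simp add: moment_def height_pole)

lemma pole_in_spheres: "(\<And>j. r j > 0) \<Longrightarrow> pole r J \<in> spheres r"
  by (simp add: spheres_def pole_nth less_imp_le)

lemma fixed_points_eq_poles:
  assumes "\<And>j. r j > 0"
  shows "fixed_points r = range (pole r)"
proof
  show "range (pole r) \<subseteq> fixed_points r"
    using assms
    by (auto simp: fixed_points_def pole_in_spheres vec_eq_iff rotz_def forall_3 vector_3 pole_nth axis_def)
  show "fixed_points r \<subseteq> range (pole r)"
  proof
    fix p assume p: "p \<in> fixed_points r"
    have "p $ j = pole r {j. p $ j $ 3 > 0} $ j" for j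
    proof -
      \<comment> \<open>Half a turn negates the two horizontal coordinates, so they vanish, and the
        norm then fixes the height up to sign.\<close>
      have "rotz pi (p $ j) = p $ j"
        using p by (metis (mono_tags, lifting) fixed_points_def mem_Collect_eq rotate_all_nth)
      then have "- (p $ j $ 1) = p $ j $ 1" "- (p $ j $ 2) = p $ j $ 2"
        by (simp_all add: rotz_def vec_eq_iff forall_3 vector_3)
      then have 0: "p $ j $ 1 = 0" "p $ j $ 2 = 0" by auto
      have "norm (p $ j) = r j" using p by (simp add: fixed_points_def spheres_def)
      then have "\<bar>p $ j $ 3\<bar> = r j" using 0 by (simp add: norm_vec_def L2_set_def sum_3)
      with 0 show ?thesis
        by (auto simp: vec_eq_iff forall_3 pole_nth axis_def)
    qed
    then show "p \<in> range (pole r)" by (metis rangeI vec_eq_iff)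
  qed
qed

lemma bounded_linear_height: "bounded_linear (height j)"
  unfolding height_def by (rule bounded_linear_compose[OF bounded_linear_vec_nth bounded_linear_vec_nth])

lemma bounded_linear_moment: "bounded_linear moment"
  unfolding moment_def by (intro bounded_linear_sum bounded_linear_height)

text \<open>Tangent vectors at a pole are horizontal in every factor, and the moment map is linear,
  hence its own derivative. So its derivative vanishes on the tangent space and the pole is
  critical.\<close>

lemma moment_pole_nonzero:
  assumes r: "\<And>j. r j > 0" and reg: "regular_value r moment 0"
  shows "moment (pole r J) \<noteq> 0"
proof
  assume "moment (pole r J) = 0"
  moreover have "pole r J \<in> spheres r" using r by (rule pole_in_spheres)
  ultimately have "frechet_derivative moment (at (pole r J)) ` tangent (pole r J) = UNIV"
    using reg by (simp add: regular_value_def)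
  moreover have "frechet_derivative moment (at (pole r J)) = moment"
    by (rule frechet_derivative_eq[OF bounded_linear_imp_has_derivative[OF bounded_linear_moment]])
  moreover have "moment v = 0" if "v \<in> tangent (pole r J)" for v
  proof -
    have "height j v = 0" for j
      using that r[of j] by (auto simp: tangent_def pole_nth height_def inner_axis' split: if_splits dest: spec[of _ j])
    then show ?thesis by (simp add: moment_def)
  qed
  ultimately show False by (metis UNIV_I imageE zero_neq_one)
qed


section \<open>The generators are equivariant cocycles\<close>

lemma form_at_function_form: "form_at (function_form f) p vs = (if vs = [] then f p else 0)"
  by (simp add: function_form.rep_eq)

lemma one_eq_function_form: "1 = function_form (\<lambda>p. 1)"
  by (intro form_at_inject[THEN iffD1] ext) (simp add: form_at_function_form one_form.rep_eq)

lemma function_form_smooth: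
  assumes "smooth f"
  shows "function_form f \<in> smooth_forms"
proof -
  have "smooth (\<lambda>p. form_at (function_form f) p vs)" for vs
    by (cases "vs = []") (simp_all add: form_at_function_form smooth_const assms)
  then show ?thesis
    by (simp add: smooth_forms_iff) (simp add: multilinear_def alternating_def form_at_function_form linear_iff)
qed

lemma function_form_even: "function_form f \<in> even_forms"
  by (rule even_formsI) (auto simp: form_at_function_form)

lemma contract_function_form [simp]: "contract X (function_form f) = 0"
  by (intro form_at_inject[THEN iffD1] ext)
    (simp add: contract.rep_eq form_at_function_form zero_form.rep_eq)

lemma form_at_ext_deriv_function_form:
  assumes "\<And>p. (f has_derivative f' p) (at p)"
  shows "form_at (ext_deriv (function_form f)) p vs = (case vs of [v] \<Rightarrow> f' p v | _ \<Rightarrow> 0)"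
proof (cases "\<exists>v. vs = [v]")
  case True
  then show ?thesis
    by (auto simp: form_at_ext_deriv deriv_raw_Cons deriv_raw_Nil form_at_function_form
        frechet_derivative_eq[OF assms])
next
  case False
  \<comment> \<open>Deleting an entry yields the empty list only from a list of length one, and a
    function is zero on every nonempty list.\<close>
  have "form_at (function_form f) q (take i vs @ drop (Suc i) vs) = 0" if "i < length vs" for i q
  proof -
    have "length vs \<noteq> 1" using False by (auto simp: length_Suc_conv)
    with that have "length (take i vs @ drop (Suc i) vs) \<noteq> 0" by simp
    then have "take i vs @ drop (Suc i) vs \<noteq> []" by (simp only: length_0_conv) simp
    then show ?thesis by (simp only: form_at_function_form if_False)
  qed
  then have "form_at (ext_deriv (function_form f)) p vs = 0"
    by (simp add: form_at_ext_deriv deriv_raw_def)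
  with False show ?thesis by (auto split: list.splits)
qed

text \<open>Covers both the complex coefficients (\<open>k = 0\<close>) and the variable t
  (\<open>k = 1\<close>, \<open>c = 1\<close>).\<close>

lemma const_cocycle:
  fixes r :: "'n::finite \<Rightarrow> real"
  shows "Poly_Mapping.single k (function_form (\<lambda>p. c)) \<in> cocycles r"
  "Poly_Mapping.single k (function_form (\<lambda>p. c)) \<in> coeffs_in even_forms"
proof -
  have "ext_deriv (function_form (\<lambda>p :: real^3^'n. c)) = 0"
    by (intro form_at_inject[THEN iffD1] ext)
      (simp add: form_at_ext_deriv_function_form[OF has_derivative_const] zero_form.rep_eq split: list.splits)
  moreover have "function_form (\<lambda>p. c) \<in> smooth_forms \<inter> invariant_forms r"
    by (simp add: function_form_smooth smooth_const invariant_forms_def form_at_function_form)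
  ultimately show "Poly_Mapping.single k (function_form (\<lambda>p. c)) \<in> cocycles r"
    by (simp add: cocycles_def cartan_forms_eq cartan_d_single vanishes_on_eq coeffs_in_0
        coeffs_in_single null_forms_0 smooth_forms_0 invariant_forms_0)
qed (intro coeffs_in_single even_forms_0 function_form_even)

section \<open>The symplectic forms of the factors\<close>

lemma form_at_sphere_form:
  "form_at (sphere_form r j) p vs =
   (case vs of [v, w] \<Rightarrow> complex_of_real (p $ j \<bullet> cross3 (v $ j) (w $ j) / (r j)\<^sup>2) | _ \<Rightarrow> 0)"
  by (simp add: sphere_form_def two_form.rep_eq split: list.split)

lemma form_at_sphere_form_eq_0: "length vs \<noteq> 2 \<Longrightarrow> form_at (sphere_form r j) p vs = 0"
  by (auto simp: form_at_sphere_form split: list.splits)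

text \<open>With constant argument vectors the form is linear in the base point; this gives
  smoothness and makes it its own derivative.\<close>

lemma bounded_linear_sphere_form: "bounded_linear (\<lambda>p. form_at (sphere_form r j) p vs)"
proof (cases "\<exists>v w. vs = [v, w]")
  case True
  have "bounded_linear (\<lambda>p :: real^3^'a. complex_of_real (p $ j \<bullet> x / c))" for x c
    by (rule bounded_linear_compose[OF bounded_linear_of_real bounded_linear_compose[OF bounded_linear_divide
        bounded_linear_compose[OF bounded_linear_inner_left bounded_linear_vec_nth]]])
  with True show ?thesis by (auto simp: form_at_sphere_form simp del: of_real_divide of_real_power)
next
  case False
  then have "length vs \<noteq> 2" by (auto simp: length_Suc_conv numeral_2_eq_2)
  then show ?thesis by (simp add: form_at_sphere_form_eq_0)
qed

lemma sphere_form_smooth: "sphere_form r j \<in> smooth_forms"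
proof -
  have lin: "multilinear (form_at (sphere_form r j) p)" for p
  proof -
    have "linear (\<lambda>v. form_at (sphere_form r j) p (us @ v # vs))" for us vs
    proof (cases "length us + length vs = 1")
      case False
      then show ?thesis by (simp add: form_at_sphere_form_eq_0 linear_iff)
    next
      case True
      then consider u where "us = [u]" "vs = []" | u where "us = []" "vs = [u]"
        by (cases us; cases vs; auto)
      then show ?thesis
        by cases (auto simp: form_at_sphere_form linear_iff cross_add_left cross_add_right cross_mult_left
            cross_mult_right inner_add_right add_divide_distrib scaleR_conv_of_real[where 'a = complex])
    qed
    then show ?thesis by (simp add: multilinear_def)
  qed
  have "alternating (form_at (sphere_form r j) p)" for p
    by (auto simp: alternating_def form_at_sphere_form split: list.splits)
  with lin show ?thesis
    by (auto simp: smooth_forms_iff smooth_bounded_linear bounded_linear_sphere_form)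
qed

lemma sphere_form_invariant: "sphere_form r j \<in> invariant_forms r"
  by (auto simp: invariant_forms_def form_at_sphere_form triple_product_rotz split: list.splits)

lemma sphere_form_even: "sphere_form r j \<in> even_forms"
  by (intro even_formsI form_at_sphere_form_eq_0) auto

text \<open>Three vectors in the plane orthogonal to p are linearly dependent.\<close>

lemma triple_product_orthogonal:
  fixes p a b c :: "real^3"
  assumes "p \<bullet> a = 0" "p \<bullet> b = 0" "p \<bullet> c = 0" "p \<noteq> 0"
  shows "a \<bullet> cross3 b c = 0"
proof -
  \<comment> \<open>Cramer's rule: p times the determinant of a, b, c, expanded in the pairwise
    cross products.\<close>
  have "(a \<bullet> cross3 b c) *\<^sub>R p = (p \<bullet> a) *\<^sub>R cross3 b c + (p \<bullet> b) *\<^sub>R cross3 c a + (p \<bullet> c) *\<^sub>R cross3 a b"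
    by (simp add: vec_eq_iff forall_3 cross3_def inner_vec_def sum_3 vector_3 algebra_simps)
  with assms show ?thesis by simp
qed

text \<open>A 3-form on a surface is zero: differentiating in the base point turns each summand into
  a triple product of vectors tangent to one 2-sphere. On lists of another length no summand
  receives two arguments.\<close>

lemma ext_deriv_sphere_form:
  assumes "\<And>j. r j > 0"
  shows "ext_deriv (sphere_form r j) \<in> null_forms r"
  unfolding null_forms_def
proof (intro CollectI ballI allI impI)
  fix p vs assume p: "p \<in> spheres r" and vs: "set vs \<subseteq> tangent p"
  have D: "frechet_derivative (\<lambda>q. form_at (sphere_form r j) q ws) (at p) =
      (\<lambda>q. form_at (sphere_form r j) q ws)" for ws
    by (rule frechet_derivative_eq[OF bounded_linear_imp_has_derivative[OF bounded_linear_sphere_form]])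
  show "form_at (ext_deriv (sphere_form r j)) p vs = 0"
  proof (cases "length vs = 3")
    case True
    then obtain a b c where abc: "vs = [a, b, c]"
      by (auto simp: length_Suc_conv numeral_3_eq_3)
    have "norm (p $ j) = r j" using p by (simp add: spheres_def)
    then have "p $ j \<noteq> 0" using assms[of j] by auto
    moreover have "p $ j \<bullet> v $ j = 0" if "v \<in> {a, b, c}" for v
      using vs that by (auto simp: abc tangent_def)
    ultimately have "a $ j \<bullet> cross3 (b $ j) (c $ j) = 0" "b $ j \<bullet> cross3 (a $ j) (c $ j) = 0"
      "c $ j \<bullet> cross3 (a $ j) (b $ j) = 0"
      by (auto intro!: triple_product_orthogonal[of "p $ j"])
    then show ?thesis
      by (simp add: abc form_at_ext_deriv deriv_raw_Cons deriv_raw_Nil D) (simp add: form_at_sphere_form)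
  next
    case False
    then show ?thesis
      by (auto simp: form_at_ext_deriv deriv_raw_def D intro!: sum.neutral form_at_sphere_form_eq_0)
  qed
qed

text \<open>The moment map equation. The division by the squared radius in
  \<open>sphere_form\<close> cancels the squared norm of the base point.\<close>

lemma contract_sphere_form:
  assumes "\<And>j. r j > 0"
  shows "ext_deriv (function_form (\<lambda>p. complex_of_real (height j p))) -
    contract fundamental_field (sphere_form r j) \<in> null_forms r"
  unfolding null_forms_def
proof (intro CollectI ballI allI impI)
  fix p vs assume p: "p \<in> spheres r" and vs: "set vs \<subseteq> tangent p"
  have D: "((\<lambda>p. complex_of_real (height j p)) has_derivative (\<lambda>v. complex_of_real (height j v))) (at p)" for p
    by (intro has_derivative_of_real bounded_linear_imp_has_derivative bounded_linear_height)
  have "form_at (contract fundamental_field (sphere_form r j)) p [w] = complex_of_real (height j w)"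
    if "w \<in> tangent p" for w
  proof -
    have "norm (p $ j) = r j" using p by (simp add: spheres_def)
    then have pp: "p $ j \<bullet> p $ j = (r j)\<^sup>2" by (simp add: dot_square_norm)
    have pw: "p $ j \<bullet> w $ j = 0" using that by (simp add: tangent_def)
    \<comment> \<open>The field is k x p with k the vertical unit vector; this is (k x p) x w = (k .
      w) p - (p . w) k, paired with p.\<close>
    have "p $ j \<bullet> cross3 (fundamental_field p $ j) (w $ j) =
        (p $ j \<bullet> p $ j) * w $ j $ 3 - (p $ j $ 3) * (p $ j \<bullet> w $ j)"
      by (simp add: fundamental_field_nth cross3_def inner_vec_def sum_3 vector_3 algebra_simps)
    also have "\<dots> = (r j)\<^sup>2 * height j w" by (simp add: pp pw height_def)
    finally show ?thesis
      using assms[of j] by (simp add: contract.rep_eq form_at_sphere_form)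
  qed
  then show "form_at (ext_deriv (function_form (\<lambda>p. complex_of_real (height j p))) -
      contract fundamental_field (sphere_form r j)) p vs = 0"
    using vs
    by (auto simp: minus_form.rep_eq form_at_ext_deriv_function_form[OF D] contract.rep_eq
        form_at_sphere_form_eq_0 split: list.splits)
qed

section \<open>The equivariant extensions and the substituted polynomials\<close>

lemma x_tilde_eq:
  "x_tilde r j = Poly_Mapping.single 0 (sphere_form r j) +
     Poly_Mapping.single 1 (function_form (\<lambda>p. complex_of_real (height j p)))"
  by (simp add: x_tilde_def mult_single)

lemma x_tilde_even: "x_tilde r j \<in> coeffs_in even_forms"
  unfolding x_tilde_eq
  by (intro coeffs_in_add coeffs_in_single even_forms_add even_forms_0 sphere_form_even function_form_even)

lemma smooth_height: "smooth (\<lambda>p. complex_of_real (height j p))"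
  by (intro smooth_bounded_linear bounded_linear_compose[OF bounded_linear_of_real] bounded_linear_height)

lemma x_tilde_cocycle:
  assumes "\<And>j. r j > 0"
  shows "x_tilde r j \<in> cocycles r"
proof -
  let ?h = "function_form (\<lambda>p. complex_of_real (height j p))"
  have "height j (rotate_all \<theta> p) = height j p" for \<theta> and p :: "real^3^'a"
    by (simp add: height_def rotz_def)
  then have h: "?h \<in> smooth_forms" "?h \<in> invariant_forms r"
    by (auto simp: function_form_smooth smooth_height invariant_forms_def form_at_function_form)
  have "x_tilde r j \<in> cartan_forms r"
    unfolding x_tilde_eq
    by (intro cartan_forms_add)
      (simp_all add: cartan_forms_eq coeffs_in_single h sphere_form_smooth sphere_form_invariant
        smooth_forms_0 invariant_forms_0)
  \<comment> \<open>The coefficient of t^2 is the contraction of a function, which is zero.\<close>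
  moreover have "cartan_d (x_tilde r j) = Poly_Mapping.single 0 (ext_deriv (sphere_form r j)) +
      Poly_Mapping.single 1 (ext_deriv ?h - contract fundamental_field (sphere_form r j))"
    unfolding x_tilde_eq
    by (subst cartan_d_add)
      (simp_all add: cartan_d_single coeffs_in_single h sphere_form_smooth smooth_forms_0 single_diff)
  moreover have "vanishes_on r \<dots>"
    using ext_deriv_sphere_form[OF assms] contract_sphere_form[OF assms]
    by (intro vanishes_on_add) (auto simp: vanishes_on_eq intro!: coeffs_in_single null_forms_0)
  ultimately show ?thesis by (simp add: cocycles_def)
qed

lemma substitute_cocycle:
  fixes r :: "'n::{finite,linorder} \<Rightarrow> real"
  assumes "\<And>j. r j > 0"
  shows "substitute r f \<in> cocycles r"
proof -
  have prod: "prod_list (map (\<lambda>j. x_tilde r j ^ e j) js) \<in> cocycles r" for e js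
  proof (induction js)
    case Nil
    then show ?case using const_cocycle(1)[of 0 1 r] by (simp add: one_eq_function_form[symmetric])
  qed (simp add: cocycles_power_mult x_tilde_cocycle assms x_tilde_even)
  have t: "Poly_Mapping.single 1 1 \<in> cocycles r"
    "(Poly_Mapping.single 1 1 :: 'n tform) \<in> coeffs_in even_forms"
    unfolding one_eq_function_form by (rule const_cocycle)+
  have "(\<Sum>i\<in>A. g i) \<in> cocycles r" if "\<And>i. i \<in> A \<Longrightarrow> g i \<in> cocycles r" for A g
    using that by (induction A rule: infinite_finite_induct) (simp_all add: cocycles_0 cocycles_add)
  then show ?thesis
    \<comment> \<open>Bracketing to the right keeps an even cocycle as the left factor of every
      product.\<close>
    unfolding substitute_def mult.assoc
    by this (intro cocycles_mult const_cocycle cocycles_power_mult t prod)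
qed


section \<open>Restriction to the fixed points\<close>

lemma coeff_pull_point: "coeff (pull_point p \<alpha>) k = form_at (Poly_Mapping.lookup \<alpha> k) p []"
  by (auto simp: pull_point_def coeff_sum in_keys_iff zero_form.rep_eq)

lemma pull_point_0 [simp]: "pull_point p 0 = 0"
  by (rule poly_eqI) (simp add: coeff_pull_point zero_form.rep_eq)

lemma pull_point_add [simp]: "pull_point p (\<alpha> + \<beta>) = pull_point p \<alpha> + pull_point p \<beta>"
  by (rule poly_eqI) (simp add: coeff_pull_point lookup_add plus_form.rep_eq)

lemma pull_point_single [simp]: "pull_point p (Poly_Mapping.single k \<omega>) = monom (form_at \<omega> p []) k"
  by (rule poly_eqI) (simp add: coeff_pull_point lookup_single when_def zero_form.rep_eq)

text \<open>On the empty list a wedge is a product of numbers: restriction to a point sees only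
  degree 0.\<close>

lemma pull_point_mult [simp]: "pull_point p (\<alpha> * \<beta>) = pull_point p \<alpha> * pull_point p \<beta>"
proof (induction \<alpha> rule: poly_mapping_single_induct)
  case (single k \<omega>)
  show ?case
    by (induction \<beta> rule: poly_mapping_single_induct)
      (simp_all add: distrib_left mult_single mult_monom times_form.rep_eq)
qed (simp_all add: distrib_right)

lemma pull_point_1 [simp]: "pull_point p 1 = 1"
  by (rule poly_eqI) (simp add: coeff_pull_point lookup_one when_def one_form.rep_eq zero_form.rep_eq)

lemma pull_point_power [simp]: "pull_point p (\<alpha> ^ k) = pull_point p \<alpha> ^ k"
  by (induction k) simp_all

lemma pull_point_sum [simp]: "pull_point p (sum g A) = (\<Sum>i\<in>A. pull_point p (g i))"
  by (induction A rule: infinite_finite_induct) simp_all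

lemma pull_point_prod_list [simp]: "pull_point p (prod_list \<alpha>s) = prod_list (map (pull_point p) \<alpha>s)"
  by (induction \<alpha>s) simp_all

lemma pull_point_x_tilde [simp]: "pull_point p (x_tilde r j) = monom (complex_of_real (height j p)) 1"
  by (simp add: x_tilde_eq form_at_sphere_form form_at_function_form)

text \<open>The values lie in a commutative ring, where the product over the sorted list is the
  unordered one; the two-form part of \<open>x_tilde\<close> dies at a point, leaving the heights of
  the pole, which are the entries of \<open>vertex\<close>.\<close>

lemma pull_point_substitute:
  "pull_point (pole r J) (substitute r f) = value_at (vertex r J) f"
proof -
  have "prod_list (map g (sorted_list_of_set UNIV)) = (\<Prod>j\<in>UNIV. g j)" for g :: "'a \<Rightarrow> complex poly"
    by (subst prod.distinct_set_conv_list[symmetric]) simp_all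
  then show ?thesis
    by (simp add: substitute_def value_at_def monomial_value_def form_at_function_form one_form.rep_eq
        o_def height_pole vertex_def monom_0 if_distrib[of complex_of_real] mult.assoc)
qed

text \<open>In form degree 0 the exterior derivative contributes nothing, and the contraction
  evaluates a one-form on the fundamental field, which is zero at a fixed point. So restriction does
  not depend on the representative.\<close>

lemma pull_point_coboundary:
  assumes "p \<in> fixed_points r" "\<alpha> \<in> coboundaries r"
  shows "pull_point p \<alpha> = 0"
proof (rule poly_eqI)
  fix k
  obtain \<beta> where \<beta>: "\<beta> \<in> cartan_forms r" "vanishes_on r (\<alpha> - cartan_d \<beta>)"
    using assms(2) by (auto simp: coboundaries_def)
  have p: "p \<in> spheres r" using assms(1) by (simp add: fixed_points_def)
  have X: "form_at (contract fundamental_field \<omega>) p [] = 0" if "\<omega> \<in> smooth_forms" for \<omega>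
  proof -
    have "linear (\<lambda>v. form_at \<omega> p ([] @ v # []))"
      using that unfolding smooth_forms_iff multilinear_def by blast
    from linear_0[OF this] show ?thesis
      by (simp add: contract.rep_eq fundamental_field_fixed[OF assms(1)])
  qed
  have d: "pull_point p (cartan_d \<beta>) = 0"
    using cartan_forms_smooth[OF \<beta>(1)] smooth_forms_0
  proof (induction \<beta> rule: coeffs_in_induct)
    case (single k \<omega>)
    have "pull_point p (- \<gamma>) = - pull_point p \<gamma>" for \<gamma>
      using pull_point_add[of p \<gamma> "- \<gamma>"] by (simp add: eq_neg_iff_add_eq_0 add.commute)
    then show ?case
      using X[OF single] pull_point_add[of p "Poly_Mapping.single k (ext_deriv \<omega>)"
          "- Poly_Mapping.single (Suc k) (contract fundamental_field \<omega>)"]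
      by (simp add: cartan_d_single form_at_ext_deriv deriv_raw_Nil)
  qed (simp_all add: cartan_d_add)
  have "form_at (Poly_Mapping.lookup (\<alpha> - cartan_d \<beta>) k) p [] = 0"
    using \<beta>(2) p by (simp add: vanishes_on_def)
  then have "coeff (pull_point p \<alpha>) k = coeff (pull_point p (cartan_d \<beta>)) k"
    by (simp add: coeff_pull_point lookup_minus minus_form.rep_eq)
  then show "coeff (pull_point p \<alpha>) k = coeff 0 k" by (simp add: d)
qed

text \<open>\<open>the_elem\<close> has its intended meaning because the image is a singleton: the
  coset is nonempty, 0 being a coboundary, and all representatives have the same
  restriction.\<close>

lemma restrict_class_eta:
  assumes "p \<in> fixed_points r"
  shows "restrict_class p (eta r f) = pull_point p (substitute r f)"
proof -
  have "0 \<in> coboundaries r"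
    unfolding coboundaries_def
    by (auto simp: cocycles_0 intro!: bexI[of _ 0] cartan_forms_0)
      (simp add: vanishes_on_eq coeffs_in_0 null_forms_0)
  then have "pull_point p ` eta r f = {pull_point p (substitute r f)}"
    by (auto simp: eta_def cohomology_class_def a_r_coset_def' ring_on_def
        pull_point_coboundary[OF assms] image_iff intro!: bexI[of _ 0])
  then show ?thesis by (simp add: restrict_class_def)
qed

lemma eta_in_HT:
  assumes "\<And>j. r j > 0"
  shows "eta r f \<in> carrier (HT r)"
proof -
  have "substitute r f \<in> cocycles r" using assms by (rule substitute_cocycle)
  then show ?thesis
    by (auto simp: HT_def FactRing_def A_RCOSETS_def' eta_def cohomology_class_def ring_on_def)
qed

theorem theorem3:
  fixes r :: "'n::{finite,linorder} \<Rightarrow> real"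
  assumes "\<And>j. r j > 0"
    and "regular_value r moment 0"
  shows "Kbar_plus r = Idl\<^bsub>poly_ring\<^esub> (family_i r \<union> {P_poly r J | J. long r J}) \<and>
         Kbar_minus r = Idl\<^bsub>poly_ring\<^esub> (family_i r \<union> {Q_poly r J | J. long r J})"
proof -
  let ?L = "{J. long r J}"
  let ?r = "\<lambda>j. - r j"
  have neg: "moment (pole r (- J)) = - moment (pole r J)" for J
    unfolding moment_pole sum_negf[symmetric] by (rule sum.cong) auto
  have up: "K \<in> ?L" if "J \<in> ?L" "J \<subseteq> K" for J K
  proof -
    have "moment (pole r J) \<le> moment (pole r K)"
      unfolding moment_pole
      by (rule sum_mono) (use that(2) assms(1) in \<open>auto intro: less_imp_le order.trans[of _ 0]\<close>)
    with that(1) show ?thesis by (simp add: long_def)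
  qed
  have compl: "- J \<in> ?L \<longleftrightarrow> J \<notin> ?L" for J
    using neg[of J] moment_pole_nonzero[OF assms, of J] by (auto simp: long_def)
  have "Kbar_plus r = {f. \<forall>S\<in>?L. value_at (vertex r S) f = 0}"
    by (auto simp: Kbar_plus_def K_plus_def eta_in_HT assms(1) fixed_points_eq_poles
        restrict_class_eta pull_point_substitute long_def)
  also have "\<dots> = Idl\<^bsub>poly_ring\<^esub> (family_i r \<union> {P_poly r J | J. J \<in> ?L})"
    by (rule vanishing_ideal) (use up compl assms(1) in \<open>auto simp: less_imp_neq[THEN not_sym]\<close>)
  finally have plus: "Kbar_plus r = \<dots>" .
  \<comment> \<open>Negating the radii reflects the cube and carries the vertex of S to that of its
    complement.\<close>
  have v: "vertex ?r S = vertex r (- S)" for S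
    by (auto simp: vertex_def)
  have "Kbar_minus r = {f. \<forall>S. moment (pole r S) < 0 \<longrightarrow> value_at (vertex r S) f = 0}"
    by (auto simp: Kbar_minus_def K_minus_def eta_in_HT assms(1) fixed_points_eq_poles
        restrict_class_eta pull_point_substitute)
  \<comment> \<open>The poles of negative moment are those of the complements of long sets.\<close>
  also have "\<dots> = {f. \<forall>S\<in>?L. value_at (vertex ?r S) f = 0}"
    unfolding v using neg by (auto simp: long_def) (metis double_complement neg_0_less_iff_less)
  \<comment> \<open>\<open>?L\<close> still consists of the long sets for \<open>r\<close>, while
    vertices and generators are taken for the negated radii. The family (i) is symmetric in the sign
    of the radii, and each P_J becomes Q_J.\<close>
  also have "\<dots> = Idl\<^bsub>poly_ring\<^esub> (family_i ?r \<union> {P_poly ?r J | J. J \<in> ?L})"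
    by (rule vanishing_ideal) (use up compl assms(1) in \<open>auto simp: less_imp_neq[THEN not_sym]\<close>)
  also have "family_i ?r = family_i r"
    by (auto simp: family_i_def const_poly_uminus mult.commute)
  also have "P_poly ?r = Q_poly r"
    by (rule ext) (simp add: P_poly_def Q_poly_def const_poly_uminus)
  finally show ?thesis using plus by simp
qed

end
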